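(* (a) For every lattice $L$ in the group $Q=\mathrm{Osc}_{1,0}$, the quotient $L\backslash X$ of $X$ (with $L$ acting by left translations, i.e. via $\iota(L)\subset G$) is straight. (b) The symmetric space $X$ also admits non-straight quotients by discrete subgroups of the isometry group: there exists a discrete subgroup $\Gamma\subset G$ acting freely and properly on $X$ with $\Gamma\backslash X$ compact such that $\Gamma\backslash X$ is non-straight.
   Context: Let $\omega(\xi,\xi')=xy'-x'y$ on $\mathbb R^2$ and $A=\begin{pmatrix}0&1\\1&0\end{pmatrix}$. The split oscillator group $Q=\mathrm{Osc}_{1,0}$ is $\mathbb R\times\mathbb R^2\times\mathbb R$ with $(z,\xi,t)(z',\xi',t')=(z+z'+\tfrac12\omega(\xi,e^{tA}\xi'),\xi+e^{tA}\xi',t+t')$. It carries a bi-invariant metric of signature $(2,2)$ given on the Lie algebra $\mathbb R\oplus\mathbb R^2\oplus\mathbb R$ by $\langle(Z,X,T),(Z',X',T')\rangle=\langle X,X'\rangle_0+ZT'+Z'T$, $\langle\cdot,\cdot\rangle_0=\mathrm{diag}(-1,1)$; the resulting symmetric space is denoted $X$. A lattice in $Q$ is a discrete subgroup $L$ with $L\backslash Q$ of finite invariant measure. Identify $\mathbb R^2\cong\mathbb C$, $iy=(0,y)$. Let $H_2=\mathbb R\times\mathbb C\times\mathbb C$ with product $(z,\xi_1,\xi_2)(\hat z,\hat\xi_1,\hat\xi_2)=(z+\hat z+\tfrac12(\omega(\xi_1,\hat\xi_1)-\omega(\xi_2,\hat\xi_2)),\xi_1+\hat\xi_1,\xi_2+\hat\xi_2)$.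 The identity component $G$ of the isometry group of $X$ is identified with $H_2\rtimes(\mathbb R\oplus\mathbb R)$, with elements $(z,\xi_1,\xi_2,t,s)$, where $(t,s)$ acts on $H_2$ by $(z,\xi_1,\xi_2)\mapsto(z,e^{tA}\eta_1,e^{tA}\eta_2)$ with $(\eta_1,\eta_2)=e^{s\phi}(\xi_1,\xi_2)$ and $\phi(\xi_1,\xi_2)=(\xi_2,\xi_1)$. Under this identification the stabiliser of the base point (the identity element of $Q$) is $G_+=\{(0,iy_1,iy_2,0,s)\mid y_1,y_2,s\in\mathbb R\}$, so $X=G/G_+$, and the group of left translations of $X$ by elements of $Q$ is the image of the homomorphism $\iota:Q\to G$, $(2z,2\xi,2t)\mapsto(z,\xi,A\xi,t,t)$. Let $p:G\to\mathbb R$, $(z,\xi_1,\xi_2,t,s)\mapsto t$. For a discrete subgroup $\Gamma\subset G$ acting freely and properly on $X$ with $\Gamma\backslash X$ compact, the quotient $\Gamma\backslash X$ is called straight if $p(\Gamma)\subset\mathbb R$ is discrete, and non-straight otherwise. *)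

theory Defs
  imports "HOL-Analysis.Analysis" "HOL-Algebra.Left_Coset"
begin

section \<open>Quotient spaces, lattices, free and proper actions\<close>

definition quotient_topology :: "'a topology \<Rightarrow> ('a \<Rightarrow> 'b) \<Rightarrow> 'b topology" where
  "quotient_topology T f =
     topology (\<lambda>U. U \<subseteq> f ` topspace T \<and> openin T {x \<in> topspace T. f x \<in> U})"

lemma openin_quotient_topology:
  "openin (quotient_topology T f) U \<longleftrightarrow>
     U \<subseteq> f ` topspace T \<and> openin T {x \<in> topspace T. f x \<in> U}"
proof -
  let ?P = "\<lambda>U. U \<subseteq> f ` topspace T \<and> openin T {x \<in> topspace T. f x \<in> U}"
  have 1: "?P (S \<inter> S')" if "?P S" "?P S'" for S S'
  proof -
    have "{x \<in> topspace T. f x \<in> S \<inter> S'}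
        = {x \<in> topspace T. f x \<in> S} \<inter> {x \<in> topspace T. f x \<in> S'}" by auto
    with that show ?thesis by auto
  qed
  have 2: "?P (\<Union>K)" if "\<forall>S\<in>K. ?P S" for K
  proof -
    have "{x \<in> topspace T. f x \<in> \<Union>K} = (\<Union>S\<in>K. {x \<in> topspace T. f x \<in> S})" by auto
    with that show ?thesis by auto
  qed
  have "istopology ?P" unfolding istopology_def using 1 2 by blast
  then show ?thesis by (simp add: quotient_topology_def topology_inverse')
qed

lemma topspace_quotient_topology: "topspace (quotient_topology T f) = f ` topspace T"
proof -
  have "{x \<in> topspace T. f x \<in> f ` topspace T} = topspace T" by auto
  then have "openin (quotient_topology T f) (f ` topspace T)"
    by (simp add: openin_quotient_topology)
  moreover have "topspace (quotient_topology T f) \<subseteq> f ` topspace T"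
    using openin_topspace[of "quotient_topology T f"] unfolding openin_quotient_topology by blast
  ultimately show ?thesis by (auto dest: openin_subset)
qed

lemma quotient_map_quotient_topology: "quotient_map T (quotient_topology T f) f"
  by (simp add: quotient_map_def topspace_quotient_topology openin_quotient_topology)

definition discrete_subgroup :: "('a::topological_space) set \<Rightarrow> 'a monoid \<Rightarrow> bool" where
  "discrete_subgroup L G \<longleftrightarrow> subgroup L G \<and> discrete L"

definition left_quotient_topology :: "'a monoid \<Rightarrow> ('a::topological_space) set \<Rightarrow> 'a set topology" where
  "left_quotient_topology G L =
     quotient_topology (top_of_set (carrier G)) (\<lambda>g. L #>\<^bsub>G\<^esub> g)"

text \<open>A lattice is a discrete subgroup \<open>L\<close> such that \<open>L\G\<close> carries a nonzero finite Borel measure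
  which is invariant under the right translations by elements of \<open>G\<close>.\<close>

definition lattice_subgroup :: "('a::topological_space) set \<Rightarrow> 'a monoid \<Rightarrow> bool" where
  "lattice_subgroup L G \<longleftrightarrow> discrete_subgroup L G \<and>
     (\<exists>M :: 'a set measure.
        space M = rcosets\<^bsub>G\<^esub> L \<and>
        sets M = sigma_sets (rcosets\<^bsub>G\<^esub> L) {U. openin (left_quotient_topology G L) U} \<and>
        emeasure M (space M) \<noteq> 0 \<and> emeasure M (space M) \<noteq> \<infinity> \<and>
        (\<forall>g\<in>carrier G. \<forall>B\<in>sets M. emeasure M ((\<lambda>C. C #>\<^bsub>G\<^esub> g) ` B) = emeasure M B))"

definition homogeneous_space :: "'a monoid \<Rightarrow> ('a::topological_space) set \<Rightarrow> 'a set topology" where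
  "homogeneous_space G H =
     quotient_topology (top_of_set (carrier G)) (\<lambda>g. g <#\<^bsub>G\<^esub> H)"

text \<open>In what follows \<open>\<Gamma>\<close> acts on the space \<open>G/H\<close> of left cosets by \<open>\<gamma> \<cdot> C = \<gamma>C\<close>.\<close>

definition acts_freely :: "'a set \<Rightarrow> 'a monoid \<Rightarrow> ('a::topological_space) set \<Rightarrow> bool" where
  "acts_freely \<Gamma> G H \<longleftrightarrow>
     (\<forall>\<gamma>\<in>\<Gamma>. \<forall>C\<in>topspace (homogeneous_space G H). \<gamma> <#\<^bsub>G\<^esub> C = C \<longrightarrow> \<gamma> = \<one>\<^bsub>G\<^esub>)"

text \<open>Properness for a discrete group \<open>\<Gamma>\<close>: the set of \<open>\<gamma>\<close> with \<open>\<gamma>K \<inter> K \<noteq> \<emptyset>\<close>, which has to be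
  compact for every compact \<open>K\<close>, is then finite.\<close>

definition acts_properly :: "'a set \<Rightarrow> 'a monoid \<Rightarrow> ('a::topological_space) set \<Rightarrow> bool" where
  "acts_properly \<Gamma> G H \<longleftrightarrow>
     (\<forall>K. compactin (homogeneous_space G H) K \<longrightarrow>
        finite {\<gamma>\<in>\<Gamma>. (\<lambda>C. \<gamma> <#\<^bsub>G\<^esub> C) ` K \<inter> K \<noteq> {}})"

definition orbit_space :: "'a set \<Rightarrow> 'a monoid \<Rightarrow> ('a::topological_space) set \<Rightarrow> 'a set set topology" where
  "orbit_space \<Gamma> G H =
     quotient_topology (homogeneous_space G H) (\<lambda>C. (\<lambda>\<gamma>. \<gamma> <#\<^bsub>G\<^esub> C) ` \<Gamma>)"


section \<open>The split oscillator group\<close>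

text \<open>The plane is identified with \<open>\<complex>\<close>, so that \<open>(x, y)\<close> is \<open>Complex x y\<close>.\<close>

definition omega :: "complex \<Rightarrow> complex \<Rightarrow> real" where
  "omega \<xi> \<xi>' = Re \<xi> * Im \<xi>' - Re \<xi>' * Im \<xi>"

definition A_map :: "complex \<Rightarrow> complex" where
  "A_map \<xi> = Complex (Im \<xi>) (Re \<xi>)"

definition phi :: "complex \<times> complex \<Rightarrow> complex \<times> complex" where
  "phi = (\<lambda>(\<xi>\<^sub>1, \<xi>\<^sub>2). (\<xi>\<^sub>2, \<xi>\<^sub>1))"

text \<open>The exponential \<open>e\<^sup>f\<close> of an endomorphism \<open>f\<close>, evaluated at \<open>v\<close>.\<close>

definition lin_exp :: "('v::real_normed_vector \<Rightarrow> 'v) \<Rightarrow> 'v \<Rightarrow> 'v" where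
  "lin_exp f v = (\<Sum>n. (1 / fact n) *\<^sub>R (f ^^ n) v)"

definition exp_tA :: "real \<Rightarrow> complex \<Rightarrow> complex" where
  "exp_tA t = lin_exp (\<lambda>\<xi>. t *\<^sub>R A_map \<xi>)"

definition exp_sphi :: "real \<Rightarrow> complex \<times> complex \<Rightarrow> complex \<times> complex" where
  "exp_sphi s = lin_exp (\<lambda>\<xi>. s *\<^sub>R phi \<xi>)"

type_synonym osc = "real \<times> complex \<times> real"

definition Osc :: "osc monoid" where
  "Osc = \<lparr>carrier = UNIV,
     mult = (\<lambda>(z, \<xi>, t) (z', \<xi>', t').
       (z + z' + omega \<xi> (exp_tA t \<xi>') / 2, \<xi> + exp_tA t \<xi>', t + t')),
     one = (0, 0, 0)\<rparr>"


section \<open>The group of isometries and the symmetric space\<close>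

type_synonym heis = "real \<times> complex \<times> complex"

definition H2 :: "heis monoid" where
  "H2 = \<lparr>carrier = UNIV,
     mult = (\<lambda>(z, \<xi>\<^sub>1, \<xi>\<^sub>2) (z', \<xi>\<^sub>1', \<xi>\<^sub>2').
       (z + z' + (omega \<xi>\<^sub>1 \<xi>\<^sub>1' - omega \<xi>\<^sub>2 \<xi>\<^sub>2') / 2, \<xi>\<^sub>1 + \<xi>\<^sub>1', \<xi>\<^sub>2 + \<xi>\<^sub>2')),
     one = (0, 0, 0)\<rparr>"

definition H2_act :: "real \<times> real \<Rightarrow> heis \<Rightarrow> heis" where
  "H2_act = (\<lambda>(t, s) (z, \<xi>\<^sub>1, \<xi>\<^sub>2).
     (let (\<eta>\<^sub>1, \<eta>\<^sub>2) = exp_sphi s (\<xi>\<^sub>1, \<xi>\<^sub>2) in (z, exp_tA t \<eta>\<^sub>1, exp_tA t \<eta>\<^sub>2)))"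

type_synonym isom = "real \<times> complex \<times> complex \<times> real \<times> real"

text \<open>The semidirect product of \<open>H2\<close> with \<open>\<real> \<oplus> \<real>\<close>; elements are \<open>(z, \<xi>\<^sub>1, \<xi>\<^sub>2, t, s)\<close>.\<close>

definition Isom :: "isom monoid" where
  "Isom = \<lparr>carrier = UNIV,
     mult = (\<lambda>(z, \<xi>\<^sub>1, \<xi>\<^sub>2, t, s) (z', \<xi>\<^sub>1', \<xi>\<^sub>2', t', s').
       (let (w, \<zeta>\<^sub>1, \<zeta>\<^sub>2) = (z, \<xi>\<^sub>1, \<xi>\<^sub>2) \<otimes>\<^bsub>H2\<^esub> H2_act (t, s) (z', \<xi>\<^sub>1', \<xi>\<^sub>2')
        in (w, \<zeta>\<^sub>1, \<zeta>\<^sub>2, t + t', s + s'))),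
     one = (0, 0, 0, 0, 0)\<rparr>"

definition Isom_plus :: "isom set" where
  "Isom_plus = {(0, Complex 0 y\<^sub>1, Complex 0 y\<^sub>2, 0, s) | y\<^sub>1 y\<^sub>2 s. True}"

text \<open>The symmetric space \<open>X\<close> is \<open>homogeneous_space Isom Isom_plus\<close>.  The next map is
  \<open>(2z, 2\<xi>, 2t) \<mapsto> (z, \<xi>, A\<xi>, t, t)\<close>.\<close>

definition iota :: "osc \<Rightarrow> isom" where
  "iota = (\<lambda>(z, \<xi>, t). (z / 2, \<xi> / 2, A_map (\<xi> / 2), t / 2, t / 2))"

definition p_proj :: "isom \<Rightarrow> real" where
  "p_proj = (\<lambda>(z, \<xi>\<^sub>1, \<xi>\<^sub>2, t, s). t)"

definition compact_quotient :: "isom set \<Rightarrow> bool" where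
  "compact_quotient \<Gamma> \<longleftrightarrow>
     discrete_subgroup \<Gamma> Isom \<and> acts_freely \<Gamma> Isom Isom_plus \<and>
     acts_properly \<Gamma> Isom Isom_plus \<and> compact_space (orbit_space \<Gamma> Isom Isom_plus)"

definition straight_quotient :: "isom set \<Rightarrow> bool" where
  "straight_quotient \<Gamma> \<longleftrightarrow> compact_quotient \<Gamma> \<and> discrete (p_proj ` \<Gamma>)"

definition non_straight_quotient :: "isom set \<Rightarrow> bool" where
  "non_straight_quotient \<Gamma> \<longleftrightarrow> compact_quotient \<Gamma> \<and> \<not> discrete (p_proj ` \<Gamma>)"


section \<open>Basic facts\<close>

lemma lin_exp_involution:
  fixes J :: "'v::real_normed_vector \<Rightarrow> 'v"
  assumes "\<And>v. J (J v) = v" and "\<And>a v. J (a *\<^sub>R v) = a *\<^sub>R J v"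
  shows "lin_exp (\<lambda>v. t *\<^sub>R J v) v = cosh t *\<^sub>R v + sinh t *\<^sub>R J v"
proof -
  have pow: "((\<lambda>v. t *\<^sub>R J v) ^^ n) v = t ^ n *\<^sub>R (if even n then v else J v)" for n
    by (induction n) (auto simp: assms)
  have c: "(\<lambda>n. (if even n then t ^ n /\<^sub>R fact n else 0) *\<^sub>R v) sums (cosh t *\<^sub>R v)"
    by (rule bounded_linear.sums[OF bounded_linear_scaleR_left cosh_converges])
  have s: "(\<lambda>n. (if even n then 0 else t ^ n /\<^sub>R fact n) *\<^sub>R J v) sums (sinh t *\<^sub>R J v)"
    by (rule bounded_linear.sums[OF bounded_linear_scaleR_left sinh_converges])
  have "(\<lambda>n. (1 / fact n) *\<^sub>R ((\<lambda>v. t *\<^sub>R J v) ^^ n) v)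
      = (\<lambda>n. (if even n then t ^ n /\<^sub>R fact n else 0) *\<^sub>R v
           + (if even n then 0 else t ^ n /\<^sub>R fact n) *\<^sub>R J v)"
    by (auto simp: pow fun_eq_iff field_simps)
  then show ?thesis
    unfolding lin_exp_def using sums_unique[OF sums_add[OF c s]] by simp
qed

lemma exp_tA_eq:
  "exp_tA t \<xi> = Complex (cosh t * Re \<xi> + sinh t * Im \<xi>) (sinh t * Re \<xi> + cosh t * Im \<xi>)"
proof -
  have "exp_tA t \<xi> = cosh t *\<^sub>R \<xi> + sinh t *\<^sub>R A_map \<xi>"
    unfolding exp_tA_def by (rule lin_exp_involution) (auto simp: A_map_def complex_eq_iff)
  then show ?thesis by (simp add: A_map_def complex_eq_iff)
qed

lemma exp_sphi_eq:
  "exp_sphi s (\<xi>\<^sub>1, \<xi>\<^sub>2) =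
     (cosh s *\<^sub>R \<xi>\<^sub>1 + sinh s *\<^sub>R \<xi>\<^sub>2, sinh s *\<^sub>R \<xi>\<^sub>1 + cosh s *\<^sub>R \<xi>\<^sub>2)"
proof -
  have "exp_sphi s (\<xi>\<^sub>1, \<xi>\<^sub>2) = cosh s *\<^sub>R (\<xi>\<^sub>1, \<xi>\<^sub>2) + sinh s *\<^sub>R phi (\<xi>\<^sub>1, \<xi>\<^sub>2)"
    unfolding exp_sphi_def by (rule lin_exp_involution) (auto simp: phi_def)
  then show ?thesis by (simp add: phi_def)
qed

lemma omega_exp_tA: "omega (exp_tA t \<xi>) (exp_tA t \<xi>') = omega \<xi> \<xi>'"
proof -
  have "omega (exp_tA t \<xi>) (exp_tA t \<xi>') = ((cosh t)\<^sup>2 - (sinh t)\<^sup>2) * omega \<xi> \<xi>'"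
    by (simp add: omega_def exp_tA_eq power2_eq_square algebra_simps)
  then show ?thesis by (simp add: hyperbolic_pythagoras)
qed

lemma exp_tA_add: "exp_tA (t + t') \<xi> = exp_tA t (exp_tA t' \<xi>)"
  by (simp add: exp_tA_eq cosh_add sinh_add algebra_simps)

lemma exp_tA_linear:
  "exp_tA t (\<xi> + \<xi>') = exp_tA t \<xi> + exp_tA t \<xi>'"
  "exp_tA t (a *\<^sub>R \<xi>) = a *\<^sub>R exp_tA t \<xi>"
  by (simp_all add: exp_tA_eq complex_eq_iff algebra_simps)

lemma exp_tA_0 [simp]: "exp_tA 0 \<xi> = \<xi>"
  by (simp add: exp_tA_eq)

lemma exp_tA_zero [simp]: "exp_tA t 0 = 0"
  by (simp add: exp_tA_eq complex_eq_iff)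

lemma omega_linear:
  "omega (\<xi> + \<xi>') \<eta> = omega \<xi> \<eta> + omega \<xi>' \<eta>" "omega \<eta> (\<xi> + \<xi>') = omega \<eta> \<xi> + omega \<eta> \<xi>'"
  "omega (a *\<^sub>R \<xi>) \<eta> = a * omega \<xi> \<eta>" "omega \<eta> (a *\<^sub>R \<xi>) = a * omega \<eta> \<xi>"
  "omega 0 \<eta> = 0" "omega \<eta> 0 = 0"
  by (simp_all add: omega_def algebra_simps)

lemma H2_act_eq:
  "H2_act (t, s) (z, \<xi>\<^sub>1, \<xi>\<^sub>2) =
     (z, exp_tA t (cosh s *\<^sub>R \<xi>\<^sub>1 + sinh s *\<^sub>R \<xi>\<^sub>2), exp_tA t (sinh s *\<^sub>R \<xi>\<^sub>1 + cosh s *\<^sub>R \<xi>\<^sub>2))"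
  by (simp add: H2_act_def exp_sphi_eq)

lemma H2_act_add: "H2_act (t + t', s + s') h = H2_act (t, s) (H2_act (t', s') h)"
proof -
  obtain z \<xi>\<^sub>1 \<xi>\<^sub>2 where "h = (z, \<xi>\<^sub>1, \<xi>\<^sub>2)" by (cases h) auto
  then show ?thesis
    by (simp add: H2_act_eq exp_tA_eq complex_eq_iff cosh_add sinh_add algebra_simps)
qed

lemma H2_act_mult: "H2_act a (h \<otimes>\<^bsub>H2\<^esub> h') = H2_act a h \<otimes>\<^bsub>H2\<^esub> H2_act a h'"
proof -
  obtain z \<xi>\<^sub>1 \<xi>\<^sub>2 z' \<xi>\<^sub>1' \<xi>\<^sub>2' t s
    where e: "h = (z, \<xi>\<^sub>1, \<xi>\<^sub>2)" "h' = (z', \<xi>\<^sub>1', \<xi>\<^sub>2')" "a = (t, s)"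
    by (cases h, cases h', cases a) auto
  have key: "omega (cosh s *\<^sub>R \<xi>\<^sub>1 + sinh s *\<^sub>R \<xi>\<^sub>2) (cosh s *\<^sub>R \<xi>\<^sub>1' + sinh s *\<^sub>R \<xi>\<^sub>2')
      - omega (sinh s *\<^sub>R \<xi>\<^sub>1 + cosh s *\<^sub>R \<xi>\<^sub>2) (sinh s *\<^sub>R \<xi>\<^sub>1' + cosh s *\<^sub>R \<xi>\<^sub>2')
      = omega \<xi>\<^sub>1 \<xi>\<^sub>1' - omega \<xi>\<^sub>2 \<xi>\<^sub>2'" (is "?l = ?r")
  proof -
    have "?l = ((cosh s)\<^sup>2 - (sinh s)\<^sup>2) * ?r"
      by (simp add: omega_def power2_eq_square algebra_simps)
    then show ?thesis by (simp add: hyperbolic_pythagoras)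
  qed
  show ?thesis
    unfolding e
    by (simp add: H2_def H2_act_eq omega_exp_tA key) (simp add: exp_tA_linear algebra_simps)
qed

lemma group_Osc: "group Osc"
proof (rule groupI)
  show "\<exists>y\<in>carrier Osc. y \<otimes>\<^bsub>Osc\<^esub> x = \<one>\<^bsub>Osc\<^esub>" for x
  proof -
    obtain z \<xi> t where x: "x = (z, \<xi>, t)" by (cases x) auto
    have "(- z, - exp_tA (- t) \<xi>, - t) \<otimes>\<^bsub>Osc\<^esub> x = \<one>\<^bsub>Osc\<^esub>"
      by (simp add: x Osc_def omega_def)
    moreover have "(- z, - exp_tA (- t) \<xi>, - t) \<in> carrier Osc" by (simp add: Osc_def)
    ultimately show ?thesis by blast
  qed
qed (auto simp: Osc_def exp_tA_linear exp_tA_add omega_linear omega_exp_tA add_divide_distrib)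

lemma Isom_mult:
  "(z, \<xi>\<^sub>1, \<xi>\<^sub>2, t, s) \<otimes>\<^bsub>Isom\<^esub> (z', \<xi>\<^sub>1', \<xi>\<^sub>2', t', s') =
     (z + z' + (omega \<xi>\<^sub>1 (exp_tA t (cosh s *\<^sub>R \<xi>\<^sub>1' + sinh s *\<^sub>R \<xi>\<^sub>2'))
              - omega \<xi>\<^sub>2 (exp_tA t (sinh s *\<^sub>R \<xi>\<^sub>1' + cosh s *\<^sub>R \<xi>\<^sub>2'))) / 2,
      \<xi>\<^sub>1 + exp_tA t (cosh s *\<^sub>R \<xi>\<^sub>1' + sinh s *\<^sub>R \<xi>\<^sub>2'),
      \<xi>\<^sub>2 + exp_tA t (sinh s *\<^sub>R \<xi>\<^sub>1' + cosh s *\<^sub>R \<xi>\<^sub>2'), t + t', s + s')"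
  by (simp add: Isom_def H2_def H2_act_eq)

lemma group_Isom: "group Isom"
proof -
  define pr :: "heis \<Rightarrow> real \<times> real \<Rightarrow> isom"
    where "pr = (\<lambda>(z, \<xi>\<^sub>1, \<xi>\<^sub>2) (t, s). (z, \<xi>\<^sub>1, \<xi>\<^sub>2, t, s))"
  have ex: "\<exists>h a. x = pr h a" for x
    by (cases x) (force simp: pr_def)
  have m: "pr h a \<otimes>\<^bsub>Isom\<^esub> pr h' a' = pr (h \<otimes>\<^bsub>H2\<^esub> H2_act a h') (a + a')" for h a h' a'
    by (auto simp: pr_def Isom_def split: prod.splits)
  have act2: "H2_act (a + a') h = H2_act a (H2_act a' h)" for a a' h
    using H2_act_add[of "fst a" "fst a'" "snd a" "snd a'" h] by (simp add: plus_prod_def)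
  have one: "\<one>\<^bsub>Isom\<^esub> = pr (0, 0, 0) (0, 0)"
    by (simp add: Isom_def pr_def)
  have act0: "H2_act (0, 0) h = h" for h
    by (cases h) (simp add: H2_act_eq)
  have H2_assoc: "(h \<otimes>\<^bsub>H2\<^esub> h') \<otimes>\<^bsub>H2\<^esub> h'' = h \<otimes>\<^bsub>H2\<^esub> (h' \<otimes>\<^bsub>H2\<^esub> h'')" for h h' h''
    by (auto simp: H2_def omega_linear add_divide_distrib diff_divide_distrib split: prod.splits)
  have H2_one: "(0, 0, 0) \<otimes>\<^bsub>H2\<^esub> h = h" for h
    by (cases h) (simp add: H2_def omega_linear)
  show ?thesis
  proof (rule groupI)
    show "x \<otimes>\<^bsub>Isom\<^esub> y \<otimes>\<^bsub>Isom\<^esub> w = x \<otimes>\<^bsub>Isom\<^esub> (y \<otimes>\<^bsub>Isom\<^esub> w)" for x y w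
    proof -
      obtain h a h' a' h'' a'' where "x = pr h a" "y = pr h' a'" "w = pr h'' a''"
        using ex by meson
      then show ?thesis by (simp only: m H2_act_mult act2 H2_assoc add.assoc)
    qed
    show "\<one>\<^bsub>Isom\<^esub> \<otimes>\<^bsub>Isom\<^esub> x = x" for x
    proof -
      obtain h a where "x = pr h a" using ex by blast
      then show ?thesis by (cases a) (simp add: one m act0 H2_one)
    qed
    show "\<exists>y\<in>carrier Isom. y \<otimes>\<^bsub>Isom\<^esub> x = \<one>\<^bsub>Isom\<^esub>" for x
    proof -
      obtain h a where x: "x = pr h a" using ex by blast
      obtain z \<xi>\<^sub>1 \<xi>\<^sub>2 where h: "H2_act (- a) h = (z, \<xi>\<^sub>1, \<xi>\<^sub>2)" by (cases "H2_act (- a) h") auto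
      have "pr (- z, - \<xi>\<^sub>1, - \<xi>\<^sub>2) (- a) \<otimes>\<^bsub>Isom\<^esub> x = \<one>\<^bsub>Isom\<^esub>"
        by (simp add: x m h one H2_def omega_def zero_prod_def)
      moreover have "pr (- z, - \<xi>\<^sub>1, - \<xi>\<^sub>2) (- a) \<in> carrier Isom" by (simp add: Isom_def)
      ultimately show ?thesis by blast
    qed
  qed (auto simp: Isom_def)
qed

lemma subgroup_Isom_plus: "subgroup Isom_plus Isom"
proof -
  interpret group Isom by (rule group_Isom)
  have ml: "(0, Complex 0 a, Complex 0 b, 0, s) \<otimes>\<^bsub>Isom\<^esub> (0, Complex 0 a', Complex 0 b', 0, s')
    = (0, Complex 0 (a + (cosh s * a' + sinh s * b')),
          Complex 0 (b + (sinh s * a' + cosh s * b')), 0, s + s')" for a b s a' b' s'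
    by (simp add: Isom_mult omega_def complex_eq_iff)
  show ?thesis
  proof (rule subgroupI)
    show "Isom_plus \<noteq> {}" by (auto simp: Isom_plus_def)
    show "a \<otimes>\<^bsub>Isom\<^esub> b \<in> Isom_plus" if "a \<in> Isom_plus" "b \<in> Isom_plus" for a b
      using that unfolding Isom_plus_def by (force simp: ml)
    show "inv\<^bsub>Isom\<^esub> g \<in> Isom_plus" if gI: "g \<in> Isom_plus" for g
    proof -
      obtain a b s where g: "g = (0, Complex 0 a, Complex 0 b, 0, s)"
        using gI unfolding Isom_plus_def by blast
      let ?k = "(0, Complex 0 (- (cosh s * a - sinh s * b)),
                  Complex 0 (- (cosh s * b - sinh s * a)), 0, - s) :: isom"
      have "?k \<otimes>\<^bsub>Isom\<^esub> g = \<one>\<^bsub>Isom\<^esub>"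
        unfolding g ml by (simp add: Isom_def complex_eq_iff)
      then have "inv\<^bsub>Isom\<^esub> g = ?k"
        by (intro inv_equality) (auto simp: Isom_def)
      then show ?thesis by (auto simp: Isom_plus_def)
    qed
  qed (auto simp: Isom_def)
qed

lemma iota_hom: "iota \<in> hom Osc Isom"
proof -
  have "iota (x \<otimes>\<^bsub>Osc\<^esub> y) = iota x \<otimes>\<^bsub>Isom\<^esub> iota y" for x y
  proof -
    obtain z \<xi> t z' \<xi>' t' where e: "x = (z, \<xi>, t)" "y = (z', \<xi>', t')"
      by (cases x, cases y) auto
    define u where "u = t / 2"
    have t: "t / 2 = u" "cosh t = cosh u * cosh u + sinh u * sinh u" "sinh t = 2 * sinh u * cosh u"
      using cosh_add[of u u] sinh_add[of u u] by (simp_all add: u_def)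
    show ?thesis
      unfolding e iota_def
      by (simp add: Osc_def Isom_mult t exp_tA_eq A_map_def omega_def complex_eq_iff
            algebra_simps add_divide_distrib diff_divide_distrib)
  qed
  then show ?thesis by (auto simp: hom_def Isom_def)
qed

text \<open>\<open>Osc\<close> acts simply transitively on \<open>X\<close> through \<open>iota\<close>, which identifies \<open>X\<close> with \<open>Osc\<close>.\<close>

lemma iota_Isom_plus_decomposition: "\<exists>!q. \<exists>k\<in>Isom_plus. g = iota q \<otimes>\<^bsub>Isom\<^esub> k"
proof (rule ex_ex1I)
  obtain w \<zeta>\<^sub>1 \<zeta>\<^sub>2 t r where g: "g = (w, \<zeta>\<^sub>1, \<zeta>\<^sub>2, t, r)" by (cases g) auto
  define P where "P = Re \<zeta>\<^sub>1 - Im \<zeta>\<^sub>2"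
  define R where "R = Im \<zeta>\<^sub>1 - Re \<zeta>\<^sub>2"
  define u where "u = cosh t * R - sinh t * P"
  define v where "v = sinh t * R - cosh t * P"
  define y\<^sub>1 where "y\<^sub>1 = cosh t * u - sinh t * v"
  define y\<^sub>2 where "y\<^sub>2 = cosh t * v - sinh t * u"
  have cs: "cosh t * cosh t = 1 + sinh t * sinh t"
    using hyperbolic_pythagoras[of t] by (simp add: power2_eq_square)
  have y: "cosh t * y\<^sub>1 + sinh t * y\<^sub>2 = u" "sinh t * y\<^sub>1 + cosh t * y\<^sub>2 = v"
    unfolding y\<^sub>1_def y\<^sub>2_def using cs by algebra+
  have PR: "sinh t * u - cosh t * v = P" "cosh t * u - sinh t * v = R"
    unfolding u_def v_def using cs by algebra+
  define \<eta> where "\<eta> = \<zeta>\<^sub>1 - exp_tA t (Complex 0 u)"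
  have z2: "\<zeta>\<^sub>2 = A_map \<eta> + exp_tA t (Complex 0 v)"
    using PR by (simp add: \<eta>_def complex_eq_iff A_map_def exp_tA_eq P_def R_def)
  define m where "m = (omega \<eta> (exp_tA t (Complex 0 u))
                      - omega (A_map \<eta>) (exp_tA t (Complex 0 v))) / 2"
  have "g = iota (2 * (w - m), 2 * \<eta>, 2 * t) \<otimes>\<^bsub>Isom\<^esub> (0, Complex 0 y\<^sub>1, Complex 0 y\<^sub>2, 0, r - t)"
  proof -
    have c: "cosh t *\<^sub>R Complex 0 y\<^sub>1 + sinh t *\<^sub>R Complex 0 y\<^sub>2 = Complex 0 u"
      "sinh t *\<^sub>R Complex 0 y\<^sub>1 + cosh t *\<^sub>R Complex 0 y\<^sub>2 = Complex 0 v"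
      using y by (simp_all add: complex_eq_iff)
    show ?thesis
      by (simp add: g iota_def Isom_mult c z2 m_def) (simp add: \<eta>_def field_simps)
  qed
  then show "\<exists>q. \<exists>k\<in>Isom_plus. g = iota q \<otimes>\<^bsub>Isom\<^esub> k"
    unfolding Isom_plus_def by blast
next
  fix q q'
  assume "\<exists>k\<in>Isom_plus. g = iota q \<otimes>\<^bsub>Isom\<^esub> k" "\<exists>k\<in>Isom_plus. g = iota q' \<otimes>\<^bsub>Isom\<^esub> k"
  then obtain k k' where k: "k \<in> Isom_plus" "k' \<in> Isom_plus"
    "iota q \<otimes>\<^bsub>Isom\<^esub> k = iota q' \<otimes>\<^bsub>Isom\<^esub> k'" by auto
  interpret I: group Isom by (rule group_Isom)
  interpret O: group Osc by (rule group_Osc)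
  interpret S: subgroup Isom_plus Isom by (rule subgroup_Isom_plus)
  interpret h: group_hom Osc Isom iota
    by (simp add: group_hom_def group_hom_axioms_def group_Osc group_Isom iota_hom)
  have UI: "x \<in> carrier Isom" for x by (simp add: Isom_def)
  have UO: "x \<in> carrier Osc" for x by (simp add: Osc_def)
  have triv: "x = \<one>\<^bsub>Osc\<^esub>" if "iota x \<in> Isom_plus" for x
    using that by (cases x) (auto simp: iota_def Isom_plus_def Osc_def A_map_def complex_eq_iff)
  define x where "x = inv\<^bsub>Osc\<^esub> q' \<otimes>\<^bsub>Osc\<^esub> q"
  have "iota q = (iota q' \<otimes>\<^bsub>Isom\<^esub> k') \<otimes>\<^bsub>Isom\<^esub> inv\<^bsub>Isom\<^esub> k"
    using k(3)[symmetric] I.inv_solve_right[OF UI UI UI] by simp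
  then have "iota q = iota q' \<otimes>\<^bsub>Isom\<^esub> (k' \<otimes>\<^bsub>Isom\<^esub> inv\<^bsub>Isom\<^esub> k)"
    by (simp only: I.m_assoc[OF UI UI UI])
  then have "inv\<^bsub>Isom\<^esub> (iota q') \<otimes>\<^bsub>Isom\<^esub> iota q = k' \<otimes>\<^bsub>Isom\<^esub> inv\<^bsub>Isom\<^esub> k"
    using I.inv_solve_left[OF UI UI UI] by metis
  then have "iota x \<in> Isom_plus"
    unfolding x_def using k by (simp add: UO)
  then have "x = \<one>\<^bsub>Osc\<^esub>" by (rule triv)
  then show "q = q'"
    unfolding x_def using O.inv_solve_left[OF UO UO UO] O.r_one[OF UO] by metis
qed

end

theory Submission
  imports Defs
begin

text \<open>Every subgroup of the isometry group that is a transversal of the stabiliser acts simply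
  transitively on \<open>X\<close>, and its cocompact discrete subgroups act freely, properly and cocompactly
  (\<open>simply_transitive.compact_quotient_image\<close>).  Both parts of the theorem use such a subgroup, of
  the form \<open>{(z, \<xi>, \<plusminus>A\<xi>, t, t)}\<close>.

  For the sign \<open>+\<close> this is the group of left translations by \<open>Osc\<close>, and the point is that a
  lattice \<open>L\<close> of \<open>Osc\<close> is cocompact and has a discrete set of heights \<open>t\<close>.  The finite invariant
  measure on \<open>L\Osc\<close> enters only by excluding continuous functions on \<open>L\Osc\<close> that some right
  translation raises by \<open>1\<close> (\<open>lattice_no_translation_cocycle\<close>).  Applied to \<open>t\<close> this gives an
  element of \<open>L\<close> of nonzero height.  Applied to functions built from the two eigencoordinates of
  \<open>A\<close> it shows that neither of them vanishes on \<open>L \<inter> {t = 0}\<close> (\<open>horizontal_eigen_coord\<close>).  Since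
  \<open>e\<^sup>t\<^sup>A\<close> preserves the projection \<open>\<Lambda>\<close> of \<open>L \<inter> {t = 0}\<close> to the plane, \<open>\<Lambda>\<close> contains two independent
  vectors, and their commutator is a nontrivial central element of \<open>L\<close>.  These elements bound a
  compact fundamental set.  The central element also makes \<open>\<Lambda>\<close> discrete, and as \<open>e\<^sup>t\<^sup>A\<close> preserves
  \<open>\<Lambda>\<close> for every height \<open>t\<close> and moves its vectors faithfully, the heights are discrete too.

  For the sign \<open>-\<close> the pair \<open>(t, t)\<close> acts trivially on the vectors \<open>(\<xi>, -A\<xi>)\<close>, so the subgroup is
  the product of a Heisenberg group with \<open>\<real>\<close>.  Here the rigidity is lost: an integral lattice may
  be sheared by a homomorphism from the Heisenberg group to \<open>\<real>\<close>, after which \<open>t\<close> takes the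
  values \<open>\<int> + \<surd>2 \<int>\<close>.\<close>

section \<open>Discrete subgroups and lattices of topological groups\<close>

text \<open>An accumulation point would yield two distinct elements of \<open>L\<close> so close to it, hence to each
  other, that their quotient lies in a neighbourhood of \<open>\<one>\<close> containing no other element of \<open>L\<close>.\<close>

lemma finite_discrete_subgroup_Int_compact:
  fixes Q :: "('a::metric_space) monoid"
  assumes "group Q" and UNIV: "carrier Q = UNIV"
    and cont: "continuous_on UNIV (\<lambda>(x, y). x \<otimes>\<^bsub>Q\<^esub> inv\<^bsub>Q\<^esub> y)"
    and L: "discrete_subgroup L Q" and "compact K"
  shows "finite (L \<inter> K)"
proof (rule ccontr)
  assume "infinite (L \<inter> K)"
  then obtain x where x: "x islimpt (L \<inter> K)"
    using \<open>compact K\<close> unfolding compact_eq_Bolzano_Weierstrass by blast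
  interpret group Q by fact
  interpret L: subgroup L Q using L by (simp add: discrete_subgroup_def)
  have "\<one>\<^bsub>Q\<^esub> isolated_in L"
    using L by (simp add: discrete_subgroup_def discreteD)
  then obtain T where T: "open T" "T \<inter> L = {\<one>\<^bsub>Q\<^esub>}"
    unfolding isolated_in_def by blast
  have "open ((\<lambda>(x, y). x \<otimes>\<^bsub>Q\<^esub> inv\<^bsub>Q\<^esub> y) -` T)"
    using cont T(1) by (rule open_vimage[rotated])
  moreover have "(x, x) \<in> (\<lambda>(x, y). x \<otimes>\<^bsub>Q\<^esub> inv\<^bsub>Q\<^esub> y) -` T"
    using T(2) by (auto simp: UNIV)
  ultimately obtain V W where VW: "open V" "open W" "x \<in> V" "x \<in> W"
    "V \<times> W \<subseteq> (\<lambda>(x, y). x \<otimes>\<^bsub>Q\<^esub> inv\<^bsub>Q\<^esub> y) -` T"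
    by (auto elim!: open_prod_elim)
  obtain y where y: "y \<in> L" "y \<in> V \<inter> W" "y \<noteq> x"
    using islimptE[OF x, of "V \<inter> W"] VW by blast
  obtain y' where y': "y' \<in> L" "y' \<in> V \<inter> W" "y' \<noteq> y"
    using islimptE[OF x, of "V \<inter> W - {y}"] VW y by (auto simp: open_Diff)
  have "y' \<otimes>\<^bsub>Q\<^esub> inv\<^bsub>Q\<^esub> y \<in> T \<inter> L"
    using y y' VW(5) by auto
  then have "y' = y"
    using T(2) by (metis UNIV UNIV_I inv_solve_right l_one singletonD)
  with y'(3) show False ..
qed

text \<open>For a continuous function \<open>f\<close> on \<open>L\G\<close> that some right translation raises by \<open>1\<close>, the sets
  \<open>{f \<ge> c}\<close> and \<open>{f \<ge> c + 1}\<close> have the same measure.  It tends to \<open>0\<close> as \<open>c \<rightarrow> \<infinity>\<close> and to the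
  total mass as \<open>c \<rightarrow> -\<infinity>\<close>, so the total mass would be \<open>0\<close>.\<close>

lemma lattice_no_translation_cocycle:
  fixes G :: "('a::topological_space) monoid" and f :: "'a \<Rightarrow> real"
  assumes "group G" and UNIV: "carrier G = UNIV" and L: "lattice_subgroup L G"
    and cont: "continuous_on UNIV f"
    and inv: "\<And>\<gamma> g. \<gamma> \<in> L \<Longrightarrow> f (\<gamma> \<otimes>\<^bsub>G\<^esub> g) = f g"
    and step: "\<And>g. f (g \<otimes>\<^bsub>G\<^esub> h) = f g + 1"
  shows False
proof -
  interpret group G by fact
  interpret L: subgroup L G using L by (simp add: lattice_subgroup_def discrete_subgroup_def)
  obtain M :: "'a set measure" where M: "space M = rcosets\<^bsub>G\<^esub> L"
    "sets M = sigma_sets (rcosets\<^bsub>G\<^esub> L) {U. openin (left_quotient_topology G L) U}"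
    "emeasure M (space M) \<noteq> 0" "emeasure M (space M) \<noteq> \<infinity>"
    and Minv: "\<And>g B. B \<in> sets M \<Longrightarrow> emeasure M ((\<lambda>C. C #>\<^bsub>G\<^esub> g) ` B) = emeasure M B"
    using L unfolding lattice_subgroup_def UNIV by auto
  have in_space: "C \<in> space M \<longleftrightarrow> (\<exists>g. C = L #>\<^bsub>G\<^esub> g)" for C
    by (auto simp: M(1) RCOSETS_def UNIV)
  \<comment> \<open>\<open>F\<close> is the function on \<open>L\G\<close> that \<open>f\<close> induces.\<close>
  define F where "F C = f (SOME x. x \<in> C)" for C
  have F: "F (L #>\<^bsub>G\<^esub> g) = f g" for g
  proof -
    have "\<exists>x. x \<in> L #>\<^bsub>G\<^esub> g" using L.one_closed unfolding r_coset_def by blast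
    then have "(SOME x. x \<in> L #>\<^bsub>G\<^esub> g) \<in> L #>\<^bsub>G\<^esub> g" by (rule someI_ex)
    then show ?thesis unfolding F_def by (auto simp: r_coset_def inv)
  qed
  have trans: "(L #>\<^bsub>G\<^esub> g) #>\<^bsub>G\<^esub> a = L #>\<^bsub>G\<^esub> (g \<otimes>\<^bsub>G\<^esub> a)" for g a
    by (rule coset_mult_assoc) (auto simp: UNIV)
  have openM: "{C \<in> space M. F C < c} \<in> sets M" for c
  proof -
    have "{g. f g < c} = f -` {..<c}" by auto
    then have "open {g. f g < c}" using cont by (simp add: open_vimage)
    moreover have "L #>\<^bsub>G\<^esub> g \<in> space M" for g using in_space by blast
    then have "{g \<in> topspace (top_of_set (carrier G)). L #>\<^bsub>G\<^esub> g \<in> {C \<in> space M. F C < c}}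
        = {g. f g < c}" by (simp add: UNIV F)
    moreover have "{C \<in> space M. F C < c} \<subseteq> (\<lambda>g. L #>\<^bsub>G\<^esub> g) ` topspace (top_of_set (carrier G))"
      using in_space by (auto simp: UNIV)
    ultimately have "openin (left_quotient_topology G L) {C \<in> space M. F C < c}"
      unfolding left_quotient_topology_def openin_quotient_topology by (simp add: UNIV)
    then show ?thesis unfolding M(2) by (intro sigma_sets.Basic) simp
  qed
  define A where "A c = {C \<in> space M. c \<le> F C}" for c
  have A: "A c \<in> sets M" for c
  proof -
    have "A c = space M - {C \<in> space M. F C < c}" by (auto simp: A_def)
    then show ?thesis using openM by auto
  qed
  have shift: "A (c + 1) = (\<lambda>C. C #>\<^bsub>G\<^esub> h) ` A c" for c
  proof (intro equalityI subsetI)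
    fix C assume "C \<in> A (c + 1)"
    then obtain g where g: "C = L #>\<^bsub>G\<^esub> g" "c + 1 \<le> f g" by (auto simp: A_def in_space F)
    define g' where "g' = g \<otimes>\<^bsub>G\<^esub> inv\<^bsub>G\<^esub> h"
    have e: "g' \<otimes>\<^bsub>G\<^esub> h = g" unfolding g'_def by (simp add: m_assoc UNIV)
    then have "L #>\<^bsub>G\<^esub> g' \<in> A c" using g step[of g'] by (auto simp: A_def in_space F)
    moreover have "C = (L #>\<^bsub>G\<^esub> g') #>\<^bsub>G\<^esub> h" by (simp add: trans e g)
    ultimately show "C \<in> (\<lambda>C. C #>\<^bsub>G\<^esub> h) ` A c" by blast
  next
    fix C assume "C \<in> (\<lambda>C. C #>\<^bsub>G\<^esub> h) ` A c"
    then obtain g where "C = (L #>\<^bsub>G\<^esub> g) #>\<^bsub>G\<^esub> h" "c \<le> f g" by (auto simp: A_def in_space F)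
    then show "C \<in> A (c + 1)" unfolding trans using step by (auto simp: A_def in_space F)
  qed
  have mu: "emeasure M (A (c + real n)) = emeasure M (A c)" for c n
  proof (induction n)
    case (Suc n)
    have "A (c + real (Suc n)) = A ((c + real n) + 1)" by (simp add: add_ac)
    then show ?case using shift[of "c + real n"] Minv[OF A] Suc by simp
  qed simp
  have null: "emeasure M (A c) = 0" for c
  proof -
    have "(\<lambda>n. emeasure M (A (c + real n))) \<longlonglongrightarrow> emeasure M (\<Inter>n. A (c + real n))"
    proof (rule Lim_emeasure_decseq)
      show "range (\<lambda>n. A (c + real n)) \<subseteq> sets M" using A by auto
      show "decseq (\<lambda>n. A (c + real n))" by (auto simp: decseq_def A_def)
      show "emeasure M (A (c + real n)) \<noteq> \<infinity>" for n
        using M(4) emeasure_space[of M "A (c + real n)"] by (auto simp: top_unique)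
    qed
    moreover have "(\<Inter>n. A (c + real n)) = {}"
    proof -
      have "\<exists>n. C \<notin> A (c + real n)" for C
      proof -
        obtain n where "F C - c < real n" using reals_Archimedean2 by blast
        then have "C \<notin> A (c + real n)" by (simp add: A_def)
        then show ?thesis ..
      qed
      then show ?thesis by blast
    qed
    ultimately show ?thesis by (simp add: mu LIMSEQ_const_iff)
  qed
  have "space M = (\<Union>n. A (- real n))"
  proof -
    have "\<exists>n. - real n \<le> F C" for C
    proof -
      obtain n where "- F C \<le> real n" using real_arch_simple by blast
      then have "- real n \<le> F C" by simp
      then show ?thesis ..
    qed
    then show ?thesis by (auto simp: A_def)
  qed
  then have "emeasure M (space M) = 0"
    using emeasure_UN_eq_0[of M "\<lambda>n. A (- real n)"] null A by auto
  with M(3) show False ..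
qed

section \<open>Groups acting simply transitively on the symmetric space\<close>

text \<open>The image of \<open>j\<close> meets every coset of the stabiliser exactly once, so \<open>Q\<close> acts simply
  transitively on \<open>X\<close>.  The map \<open>r\<close> sends \<open>g\<close> to the unique \<open>q\<close> that moves the base point to the
  same place as \<open>g\<close> does; its continuity makes the orbit map \<open>Q \<rightarrow> X\<close> a homeomorphism.\<close>

locale simply_transitive =
  fixes Q :: "osc monoid" and j :: "osc \<Rightarrow> isom" and r :: "isom \<Rightarrow> osc"
  assumes group_Q: "group Q" and UNIV_Q: "carrier Q = UNIV"
    and continuous_divide: "continuous_on UNIV (\<lambda>(x, y). x \<otimes>\<^bsub>Q\<^esub> inv\<^bsub>Q\<^esub> y)"
    and hom_j: "j \<in> hom Q Isom" and continuous_j: "continuous_on UNIV j"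
    and continuous_r: "continuous_on UNIV r"
    and r_j: "\<And>q k. k \<in> Isom_plus \<Longrightarrow> r (j q \<otimes>\<^bsub>Isom\<^esub> k) = q"
    and decompose: "\<And>g. \<exists>k\<in>Isom_plus. g = j (r g) \<otimes>\<^bsub>Isom\<^esub> k"
begin

sublocale Q: group Q by (rule group_Q)
sublocale I: group Isom by (rule group_Isom)
sublocale P: subgroup Isom_plus Isom by (rule subgroup_Isom_plus)
sublocale j: group_hom Q Isom j
  by (simp add: group_hom_def group_hom_axioms_def group_Q group_Isom hom_j)

lemma UNIV_Isom: "carrier Isom = UNIV"
  by (simp add: Isom_def)

lemma r_j' [simp]: "r (j q) = q"
  using r_j[OF P.one_closed, of q] by (simp add: UNIV_Isom)

lemma r_right: "r (g \<otimes>\<^bsub>Isom\<^esub> k) = r g" if k: "k \<in> Isom_plus"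
proof -
  obtain k' where k': "k' \<in> Isom_plus" "g = j (r g) \<otimes>\<^bsub>Isom\<^esub> k'" using decompose by blast
  have "g \<otimes>\<^bsub>Isom\<^esub> k = j (r g) \<otimes>\<^bsub>Isom\<^esub> (k' \<otimes>\<^bsub>Isom\<^esub> k)"
    by (subst k'(2)) (simp add: I.m_assoc UNIV_Isom)
  then show ?thesis using r_j[of "k' \<otimes>\<^bsub>Isom\<^esub> k" "r g"] k k'(1) by simp
qed

lemma r_left: "r (j q \<otimes>\<^bsub>Isom\<^esub> g) = q \<otimes>\<^bsub>Q\<^esub> r g"
proof -
  obtain k where k: "k \<in> Isom_plus" "g = j (r g) \<otimes>\<^bsub>Isom\<^esub> k" using decompose by blast
  have "j q \<otimes>\<^bsub>Isom\<^esub> g = j (q \<otimes>\<^bsub>Q\<^esub> r g) \<otimes>\<^bsub>Isom\<^esub> k"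
    by (subst k(2)) (simp add: I.m_assoc UNIV_Isom UNIV_Q)
  then show ?thesis using r_j[OF k(1)] by simp
qed

abbreviation coset :: "isom \<Rightarrow> isom set" where
  "coset g \<equiv> g <#\<^bsub>Isom\<^esub> Isom_plus"

lemma coset_r: "coset g = coset (j (r g))"
proof -
  obtain k where k: "k \<in> Isom_plus" "g = j (r g) \<otimes>\<^bsub>Isom\<^esub> k" using decompose by blast
  have "coset g = j (r g) <#\<^bsub>Isom\<^esub> coset k"
    by (subst k(2), subst I.lcos_m_assoc) (auto simp: UNIV_Isom)
  then show ?thesis using I.coset_join3[OF _ P.subgroup_axioms k(1)] by (simp add: UNIV_Isom)
qed

lemma coset_mult: "h <#\<^bsub>Isom\<^esub> coset g = coset (h \<otimes>\<^bsub>Isom\<^esub> g)"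
  by (rule I.lcos_m_assoc) (auto simp: UNIV_Isom)

lemma coset_topspace: "C \<in> topspace (homogeneous_space Isom Isom_plus) \<longleftrightarrow> (\<exists>g. C = coset g)"
  unfolding homogeneous_space_def topspace_quotient_topology UNIV_Isom image_iff by simp

text \<open>The inverse \<open>X \<rightarrow> Q\<close> of the orbit map.\<close>

definition coset_pt :: "isom set \<Rightarrow> osc" where
  "coset_pt C = r (SOME g. g \<in> C)"

lemma coset_pt [simp]: "coset_pt (coset g) = r g"
proof -
  have "\<exists>h. h \<in> coset g" using P.one_closed unfolding l_coset_def by blast
  then have "(SOME h. h \<in> coset g) \<in> coset g" by (rule someI_ex)
  then show ?thesis unfolding coset_pt_def by (auto simp: l_coset_def r_right)
qed

lemma continuous_coset: "continuous_map euclidean (homogeneous_space Isom Isom_plus) coset"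
  using quotient_map_quotient_topology[of "top_of_set (carrier Isom)" coset]
  by (simp add: homogeneous_space_def UNIV_Isom quotient_imp_continuous_map)

lemma continuous_coset_pt: "continuous_map (homogeneous_space Isom Isom_plus) euclidean coset_pt"
proof -
  have "continuous_map euclidean euclidean (coset_pt \<circ> coset)"
    using continuous_r by (simp add: o_def)
  moreover have "quotient_map euclidean (homogeneous_space Isom Isom_plus) coset"
    using quotient_map_quotient_topology[of "top_of_set (carrier Isom)" coset]
    by (simp add: homogeneous_space_def UNIV_Isom)
  ultimately show ?thesis by (metis continuous_compose_quotient_map)
qed

text \<open>Under the homeomorphism \<open>X \<cong> Q\<close> the action of \<open>j ` L\<close> becomes left multiplication by \<open>L\<close>,
  which is free, and proper because \<open>\<gamma>K \<inter> K \<noteq> \<emptyset>\<close> puts \<open>\<gamma>\<close> into the compact set \<open>K K\<inverse>\<close>.\<close>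

proposition compact_quotient_image:
  assumes L: "discrete_subgroup L Q" and "compact C"
    and C: "\<And>q. \<exists>\<gamma>\<in>L. \<exists>c\<in>C. q = \<gamma> \<otimes>\<^bsub>Q\<^esub> c"
  shows "compact_quotient (j ` L)"
  unfolding compact_quotient_def
proof (intro conjI)
  interpret L: subgroup L Q using L by (simp add: discrete_subgroup_def)
  show "discrete_subgroup (j ` L) Isom"
    unfolding discrete_subgroup_def
  proof
    show "subgroup (j ` L) Isom" by (rule j.subgroup_img_is_subgroup[OF L.subgroup_axioms])
    show "discrete (j ` L)"
    proof (rule discreteI)
      fix x assume "x \<in> j ` L"
      then obtain q where q: "q \<in> L" "x = j q" by blast
      then obtain T where T: "open T" "T \<inter> L = {q}"
        using L by (auto simp: discrete_subgroup_def discrete_def isolated_in_def)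
      have "open (r -` T)" using T(1) continuous_r by (rule open_vimage)
      moreover have "r -` T \<inter> j ` L = {x}" using T(2) q by (auto simp: image_iff)
      ultimately show "x isolated_in j ` L" unfolding isolated_in_def using q by blast
    qed
  qed
  show "acts_freely (j ` L) Isom Isom_plus"
    unfolding acts_freely_def
  proof (intro ballI impI)
    fix \<gamma> C assume "\<gamma> \<in> j ` L" "C \<in> topspace (homogeneous_space Isom Isom_plus)"
      and fix_C: "\<gamma> <#\<^bsub>Isom\<^esub> C = C"
    then obtain q g where q: "\<gamma> = j q" "C = coset g" by (auto simp: coset_topspace)
    have "q \<otimes>\<^bsub>Q\<^esub> r g = r g"
      using arg_cong[OF fix_C, of coset_pt] by (simp add: q coset_mult r_left)
    then have "q = \<one>\<^bsub>Q\<^esub>" by (simp add: Q.r_cancel_one UNIV_Q)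
    then show "\<gamma> = \<one>\<^bsub>Isom\<^esub>" by (simp add: q)
  qed
  show "acts_properly (j ` L) Isom Isom_plus"
    unfolding acts_properly_def
  proof (intro allI impI)
    fix K assume K: "compactin (homogeneous_space Isom Isom_plus) K"
    define K' where "K' = coset_pt ` K"
    have "compact K'"
      using image_compactin[OF K continuous_coset_pt] by (simp add: K'_def)
    then have "compact ((\<lambda>(x, y). x \<otimes>\<^bsub>Q\<^esub> inv\<^bsub>Q\<^esub> y) ` (K' \<times> K'))"
      by (intro compact_continuous_image compact_Times continuous_on_subset[OF continuous_divide]) auto
    then have fin: "finite (L \<inter> (\<lambda>(x, y). x \<otimes>\<^bsub>Q\<^esub> inv\<^bsub>Q\<^esub> y) ` (K' \<times> K'))"
      by (rule finite_discrete_subgroup_Int_compact[OF group_Q UNIV_Q continuous_divide L])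
    have "{\<gamma> \<in> j ` L. (\<lambda>C. \<gamma> <#\<^bsub>Isom\<^esub> C) ` K \<inter> K \<noteq> {}}
        \<subseteq> j ` (L \<inter> (\<lambda>(x, y). x \<otimes>\<^bsub>Q\<^esub> inv\<^bsub>Q\<^esub> y) ` (K' \<times> K'))"
    proof
      fix \<gamma> assume "\<gamma> \<in> {\<gamma> \<in> j ` L. (\<lambda>C. \<gamma> <#\<^bsub>Isom\<^esub> C) ` K \<inter> K \<noteq> {}}"
      then obtain q C where q: "q \<in> L" "\<gamma> = j q" "C \<in> K" "\<gamma> <#\<^bsub>Isom\<^esub> C \<in> K" by auto
      obtain g where g: "C = coset g"
        using q(3) compactin_subset_topspace[OF K] coset_topspace by blast
      have "q \<otimes>\<^bsub>Q\<^esub> r g \<in> K'" "r g \<in> K'"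
        using imageI[OF q(4), of coset_pt] imageI[OF q(3), of coset_pt]
        by (simp_all add: K'_def g q(2) coset_mult r_left)
      moreover have "q = (q \<otimes>\<^bsub>Q\<^esub> r g) \<otimes>\<^bsub>Q\<^esub> inv\<^bsub>Q\<^esub> (r g)"
        by (simp add: Q.m_assoc UNIV_Q)
      ultimately have "q \<in> (\<lambda>(x, y). x \<otimes>\<^bsub>Q\<^esub> inv\<^bsub>Q\<^esub> y) ` (K' \<times> K')"
        by (intro image_eqI[of _ _ "(q \<otimes>\<^bsub>Q\<^esub> r g, r g)"]) auto
      then show "\<gamma> \<in> j ` (L \<inter> (\<lambda>(x, y). x \<otimes>\<^bsub>Q\<^esub> inv\<^bsub>Q\<^esub> y) ` (K' \<times> K'))"
        using q by blast
    qed
    then show "finite {\<gamma> \<in> j ` L. (\<lambda>C. \<gamma> <#\<^bsub>Isom\<^esub> C) ` K \<inter> K \<noteq> {}}"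
      using fin by (meson finite_imageI finite_subset)
  qed
  show "compact_space (orbit_space (j ` L) Isom Isom_plus)"
  proof -
    let ?X = "homogeneous_space Isom Isom_plus"
    let ?orb = "\<lambda>C. (\<lambda>\<gamma>. \<gamma> <#\<^bsub>Isom\<^esub> C) ` (j ` L)"
    have "compactin euclidean (j ` C)"
      using \<open>compact C\<close> by (auto intro: compact_continuous_image continuous_on_subset[OF continuous_j])
    then have "compactin ?X (coset ` j ` C)"
      using continuous_coset by (rule image_compactin)
    moreover have "continuous_map ?X (orbit_space (j ` L) Isom Isom_plus) ?orb"
      unfolding orbit_space_def
      by (rule quotient_imp_continuous_map[OF quotient_map_quotient_topology])
    ultimately have cpt: "compactin (orbit_space (j ` L) Isom Isom_plus) (?orb ` coset ` j ` C)"
      by (rule image_compactin)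
    have "topspace (orbit_space (j ` L) Isom Isom_plus) \<subseteq> ?orb ` coset ` j ` C"
    proof
      fix B assume "B \<in> topspace (orbit_space (j ` L) Isom Isom_plus)"
      then obtain g where g: "B = ?orb (coset g)"
        by (auto simp: orbit_space_def topspace_quotient_topology coset_topspace)
      obtain \<gamma> c where c: "\<gamma> \<in> L" "c \<in> C" "r g = \<gamma> \<otimes>\<^bsub>Q\<^esub> c" using C by blast
      have e: "coset g = j \<gamma> <#\<^bsub>Isom\<^esub> coset (j c)"
        using coset_r[of g] by (simp add: c coset_mult UNIV_Q)
      have "?orb (coset g) = ?orb (coset (j c))"
      proof (intro equalityI subsetI)
        fix D assume "D \<in> ?orb (coset g)"
        then obtain \<delta> where d: "\<delta> \<in> L" "D = j \<delta> <#\<^bsub>Isom\<^esub> coset g" by auto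
        then have "D = j (\<delta> \<otimes>\<^bsub>Q\<^esub> \<gamma>) <#\<^bsub>Isom\<^esub> coset (j c)"
          by (simp add: e coset_mult UNIV_Q UNIV_Isom I.m_assoc)
        then show "D \<in> ?orb (coset (j c))" using d(1) c(1) by blast
      next
        fix D assume "D \<in> ?orb (coset (j c))"
        then obtain \<delta> where d: "\<delta> \<in> L" "D = j \<delta> <#\<^bsub>Isom\<^esub> coset (j c)" by auto
        have "D = j (\<delta> \<otimes>\<^bsub>Q\<^esub> inv\<^bsub>Q\<^esub> \<gamma>) <#\<^bsub>Isom\<^esub> coset g"
        proof -
          have "inv\<^bsub>Q\<^esub> \<gamma> \<otimes>\<^bsub>Q\<^esub> (\<gamma> \<otimes>\<^bsub>Q\<^esub> c) = c" by (simp add: UNIV_Q flip: Q.m_assoc)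
          then have "j ((\<delta> \<otimes>\<^bsub>Q\<^esub> inv\<^bsub>Q\<^esub> \<gamma>) \<otimes>\<^bsub>Q\<^esub> (\<gamma> \<otimes>\<^bsub>Q\<^esub> c)) = j (\<delta> \<otimes>\<^bsub>Q\<^esub> c)" by (simp add: Q.m_assoc UNIV_Q)
          then have "j (\<delta> \<otimes>\<^bsub>Q\<^esub> inv\<^bsub>Q\<^esub> \<gamma>) \<otimes>\<^bsub>Isom\<^esub> (j \<gamma> \<otimes>\<^bsub>Isom\<^esub> j c) = j \<delta> \<otimes>\<^bsub>Isom\<^esub> j c"
            by (simp add: UNIV_Q)
          then show ?thesis unfolding d(2) e coset_mult by simp
        qed
        then show "D \<in> ?orb (coset g)" using d(1) c(1) by blast
      qed
      then show "B \<in> ?orb ` coset ` j ` C" using g c(2) by blast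
    qed
    then show ?thesis
      using cpt compactin_subset_topspace[OF cpt] unfolding compact_space_def
      by (metis subset_antisym)
  qed
qed

end

section \<open>The hyperbolic rotations and two sections of the orbit map\<close>

lemma continuous_on_exp_tA [continuous_intros]:
  "continuous_on S f \<Longrightarrow> continuous_on S g \<Longrightarrow> continuous_on S (\<lambda>x. exp_tA (f x) (g x))"
  unfolding exp_tA_eq by (intro continuous_intros)

lemma continuous_on_omega [continuous_intros]:
  "continuous_on S f \<Longrightarrow> continuous_on S g \<Longrightarrow> continuous_on S (\<lambda>x. omega (f x) (g x))"
  unfolding omega_def by (intro continuous_intros)

lemma continuous_on_A_map [continuous_intros]:
  "continuous_on S f \<Longrightarrow> continuous_on S (\<lambda>x. A_map (f x))"
  unfolding A_map_def by (intro continuous_intros)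

lemma exp_tA_uminus_cancel [simp]:
  "exp_tA (- t) (exp_tA t \<xi>) = \<xi>" "exp_tA t (exp_tA (- t) \<xi>) = \<xi>"
  by (simp_all flip: exp_tA_add)

lemma exp_tA_minus: "exp_tA t (- \<xi>) = - exp_tA t \<xi>"
  by (simp add: exp_tA_eq complex_eq_iff)

lemma A_map_exp_tA: "A_map (exp_tA t \<xi>) = exp_tA t (A_map \<xi>)"
  by (simp add: A_map_def exp_tA_eq algebra_simps)

lemma omega_self [simp]: "omega \<xi> \<xi> = 0"
  by (simp add: omega_def)

lemma omega_minus [simp]: "omega (- \<xi>) \<eta> = - omega \<xi> \<eta>" "omega \<xi> (- \<eta>) = - omega \<xi> \<eta>"
  by (simp_all add: omega_def)

text \<open>For \<open>\<epsilon> = 1\<close> the image consists of the left translations by elements of the oscillator group.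
  Changing the sign of \<open>A\<close> gives another transversal of the stabiliser that is again a subgroup.\<close>

definition transversal :: "real \<Rightarrow> osc \<Rightarrow> isom" where
  "transversal \<epsilon> = (\<lambda>(z, \<xi>, t). (z, \<xi>, \<epsilon> *\<^sub>R A_map \<xi>, t, t))"

text \<open>In the coset of \<open>(w, \<zeta>\<^sub>1, \<zeta>\<^sub>2, t, s)\<close> the vectors \<open>\<zeta>\<^sub>1, \<zeta>\<^sub>2\<close> vary by \<open>e\<^sup>t\<^sup>A\<close> applied to imaginary
  vectors.  Hence the real parts of \<open>e\<^sup>-\<^sup>t\<^sup>A \<zeta>\<^sub>i\<close> are invariants of the coset, and they determine its
  representative of the form \<open>(z, \<xi>, \<plusminus>A\<xi>, t, t)\<close>, as \<open>A\<close> exchanges real and imaginary parts.\<close>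

definition transversal_coords :: "real \<Rightarrow> isom \<Rightarrow> osc" where
  "transversal_coords \<epsilon> = (\<lambda>(w, \<zeta>\<^sub>1, \<zeta>\<^sub>2, t, s).
     (let \<xi> = exp_tA t (Complex (Re (exp_tA (- t) \<zeta>\<^sub>1)) (\<epsilon> * Re (exp_tA (- t) \<zeta>\<^sub>2)))
      in (w - (omega \<xi> \<zeta>\<^sub>1 - \<epsilon> * omega (A_map \<xi>) \<zeta>\<^sub>2) / 2, \<xi>, t)))"

lemma continuous_on_transversal: "continuous_on UNIV (transversal \<epsilon>)"
  unfolding transversal_def case_prod_unfold by (intro continuous_intros)

lemma continuous_on_transversal_coords: "continuous_on UNIV (transversal_coords \<epsilon>)"
  unfolding transversal_coords_def case_prod_unfold Let_def by (intro continuous_intros) auto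

lemma transversal_coords_mult:
  assumes \<epsilon>: "\<epsilon>\<^sup>2 = 1" and k: "k \<in> Isom_plus"
  shows "transversal_coords \<epsilon> (transversal \<epsilon> q \<otimes>\<^bsub>Isom\<^esub> k) = q"
proof -
  obtain z \<xi> t where q: "q = (z, \<xi>, t)" by (cases q) auto
  obtain a b s where k: "k = (0, Complex 0 a, Complex 0 b, 0, s)"
    using k unfolding Isom_plus_def by blast
  have ee: "\<epsilon> * (\<epsilon> * x) = x" for x using \<epsilon> by (simp add: power2_eq_square flip: mult.assoc)
  define u where "u = cosh t * a + sinh t * b"
  define v where "v = sinh t * a + cosh t * b"
  have uv: "cosh t *\<^sub>R Complex 0 a + sinh t *\<^sub>R Complex 0 b = Complex 0 u"
    "sinh t *\<^sub>R Complex 0 a + cosh t *\<^sub>R Complex 0 b = Complex 0 v"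
    by (simp_all add: u_def v_def complex_eq_iff)
  define \<eta> where "\<eta> = exp_tA (- t) \<xi>"
  have "Re (exp_tA (- t) (\<xi> + exp_tA t (Complex 0 u))) = Re \<eta>"
    by (simp add: exp_tA_linear \<eta>_def)
  moreover have "Re (exp_tA (- t) (\<epsilon> *\<^sub>R A_map \<xi> + exp_tA t (Complex 0 v))) = \<epsilon> * Im \<eta>"
    by (simp add: exp_tA_linear \<eta>_def flip: A_map_exp_tA) (simp add: A_map_def)
  ultimately have \<xi>: "exp_tA t (Complex (Re (exp_tA (- t) (\<xi> + exp_tA t (Complex 0 u))))
      (\<epsilon> * Re (exp_tA (- t) (\<epsilon> *\<^sub>R A_map \<xi> + exp_tA t (Complex 0 v))))) = \<xi>"
    by (simp add: ee) (simp add: \<eta>_def)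
  show ?thesis
    by (simp add: q k transversal_def Isom_mult uv transversal_coords_def \<xi> Let_def omega_linear ee)
qed

lemma transversal_decomposition:
  assumes \<epsilon>: "\<epsilon>\<^sup>2 = 1"
  shows "\<exists>k\<in>Isom_plus. g = transversal \<epsilon> (transversal_coords \<epsilon> g) \<otimes>\<^bsub>Isom\<^esub> k"
proof -
  obtain w \<zeta>\<^sub>1 \<zeta>\<^sub>2 t s where g: "g = (w, \<zeta>\<^sub>1, \<zeta>\<^sub>2, t, s)" by (cases g) auto
  have ee: "\<epsilon> * (\<epsilon> * x) = x" for x using \<epsilon> by (simp add: power2_eq_square flip: mult.assoc)
  define \<eta> where "\<eta> = Complex (Re (exp_tA (- t) \<zeta>\<^sub>1)) (\<epsilon> * Re (exp_tA (- t) \<zeta>\<^sub>2))"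
  define \<xi> where "\<xi> = exp_tA t \<eta>"
  define u where "u = Im (exp_tA (- t) \<zeta>\<^sub>1 - \<eta>)"
  define v where "v = Im (exp_tA (- t) \<zeta>\<^sub>2 - \<epsilon> *\<^sub>R A_map \<eta>)"
  have "exp_tA (- t) \<zeta>\<^sub>1 = \<eta> + Complex 0 u"
    by (simp add: \<eta>_def u_def complex_eq_iff)
  from arg_cong[OF this, of "exp_tA t"] have \<zeta>\<^sub>1: "\<zeta>\<^sub>1 = \<xi> + exp_tA t (Complex 0 u)"
    by (simp add: exp_tA_linear \<xi>_def)
  have "exp_tA (- t) \<zeta>\<^sub>2 = \<epsilon> *\<^sub>R A_map \<eta> + Complex 0 v"
    by (simp add: \<eta>_def v_def complex_eq_iff A_map_def ee)
  from arg_cong[OF this, of "exp_tA t"]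
  have \<zeta>\<^sub>2: "\<zeta>\<^sub>2 = \<epsilon> *\<^sub>R A_map \<xi> + exp_tA t (Complex 0 v)"
    by (simp add: exp_tA_linear \<xi>_def A_map_exp_tA)
  \<comment> \<open>The stabiliser element has to give \<open>(iu, iv)\<close> after the action of \<open>e\<^sup>t\<^sup>\<phi>\<close>, which is undone here.\<close>
  define a where "a = cosh t * u - sinh t * v"
  define b where "b = cosh t * v - sinh t * u"
  have cs: "cosh t * cosh t = 1 + sinh t * sinh t"
    using hyperbolic_pythagoras[of t] by (simp add: power2_eq_square)
  have "cosh t * a + sinh t * b = u" "sinh t * a + cosh t * b = v"
    unfolding a_def b_def using cs by algebra+
  then have uv: "cosh t *\<^sub>R Complex 0 a + sinh t *\<^sub>R Complex 0 b = Complex 0 u"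
    "sinh t *\<^sub>R Complex 0 a + cosh t *\<^sub>R Complex 0 b = Complex 0 v"
    by (simp_all add: complex_eq_iff)
  have ret: "transversal_coords \<epsilon> g = (w - (omega \<xi> \<zeta>\<^sub>1 - \<epsilon> * omega (A_map \<xi>) \<zeta>\<^sub>2) / 2, \<xi>, t)"
    by (simp add: g transversal_coords_def Let_def \<xi>_def \<eta>_def)
  have "g = transversal \<epsilon> (transversal_coords \<epsilon> g) \<otimes>\<^bsub>Isom\<^esub> (0, Complex 0 a, Complex 0 b, 0, s - t)"
    unfolding ret transversal_def by (simp add: Isom_mult uv) (simp add: g \<zeta>\<^sub>1 \<zeta>\<^sub>2 omega_linear)
  then show ?thesis unfolding Isom_plus_def by blast
qed

section \<open>Lattices in the split oscillator group\<close>

lemma Osc_mult: "(z, \<xi>, t) \<otimes>\<^bsub>Osc\<^esub> (z', \<xi>', t') =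
    (z + z' + omega \<xi> (exp_tA t \<xi>') / 2, \<xi> + exp_tA t \<xi>', t + t')"
  by (simp add: Osc_def)

lemma UNIV_Osc: "carrier Osc = UNIV"
  by (simp add: Osc_def)

lemma Osc_inv: "inv\<^bsub>Osc\<^esub> (z, \<xi>, t) = (- z, - exp_tA (- t) \<xi>, - t)"
proof (rule group.inv_equality[OF group_Osc])
  show "(- z, - exp_tA (- t) \<xi>, - t) \<otimes>\<^bsub>Osc\<^esub> (z, \<xi>, t) = \<one>\<^bsub>Osc\<^esub>"
    by (simp add: Osc_mult) (simp add: Osc_def)
qed (auto simp: UNIV_Osc)

lemma Osc_divide:
  "(z, \<xi>, t) \<otimes>\<^bsub>Osc\<^esub> inv\<^bsub>Osc\<^esub> (z', \<xi>', t') =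
     (z - z' - omega \<xi> (exp_tA (t - t') \<xi>') / 2, \<xi> - exp_tA (t - t') \<xi>', t - t')"
  by (simp add: Osc_inv Osc_mult exp_tA_minus flip: exp_tA_add)

text \<open>The factor \<open>2\<close> undoes the halving in \<open>iota\<close>.\<close>

interpretation Osc: simply_transitive Osc iota "\<lambda>g. 2 *\<^sub>R transversal_coords 1 g"
proof (rule simply_transitive.intro)
  have iota: "iota q = transversal 1 ((1/2) *\<^sub>R q)" for q
    by (cases q) (simp add: iota_def transversal_def A_map_def complex_eq_iff)
  show "iota \<in> hom Osc Isom" by (rule iota_hom)
  show "continuous_on UNIV iota"
    unfolding iota_def case_prod_unfold by (intro continuous_intros) auto
  show "continuous_on UNIV (\<lambda>g. 2 *\<^sub>R transversal_coords 1 g)"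
    by (intro continuous_intros continuous_on_transversal_coords)
  show "2 *\<^sub>R transversal_coords 1 (iota q \<otimes>\<^bsub>Isom\<^esub> k) = q" if "k \<in> Isom_plus" for q k
    by (simp add: iota transversal_coords_mult that)
  show "\<exists>k\<in>Isom_plus. g = iota (2 *\<^sub>R transversal_coords 1 g) \<otimes>\<^bsub>Isom\<^esub> k" for g
    using transversal_decomposition[of 1 g] by (simp add: iota)
  have "(\<lambda>(x, y). x \<otimes>\<^bsub>Osc\<^esub> inv\<^bsub>Osc\<^esub> y) = (\<lambda>((z, \<xi>, t), (z', \<xi>', t')).
     (z - z' - omega \<xi> (exp_tA (t - t') \<xi>') / 2, \<xi> - exp_tA (t - t') \<xi>', t - t'))"
    by (simp add: fun_eq_iff Osc_divide)
  then show "continuous_on UNIV (\<lambda>(x, y). x \<otimes>\<^bsub>Osc\<^esub> inv\<^bsub>Osc\<^esub> y)"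
    by (simp only: case_prod_unfold) (intro continuous_intros; simp)
qed (auto simp: UNIV_Osc group_Osc)

text \<open>The coordinates of \<open>\<xi>\<close> in the eigenbasis of \<open>A\<close>, up to scaling, for the eigenvalues
  \<open>\<sigma> = \<plusminus>1\<close>.\<close>

definition eigen_coord :: "real \<Rightarrow> complex \<Rightarrow> real" where
  "eigen_coord \<sigma> \<xi> = Re \<xi> + \<sigma> * Im \<xi>"

lemma eigen_coord_exp_tA:
  assumes "\<sigma> = 1 \<or> \<sigma> = -1"
  shows "eigen_coord \<sigma> (exp_tA t \<xi>) = exp (\<sigma> * t) * eigen_coord \<sigma> \<xi>"
proof -
  have "exp (\<sigma> * t) = cosh t + \<sigma> * sinh t"
    using assms by (auto simp: sinh_def cosh_def field_simps)
  then show ?thesis using assms by (auto simp: eigen_coord_def exp_tA_eq algebra_simps)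
qed

lemma eigen_coord_linear:
  "eigen_coord \<sigma> (\<xi> + \<eta>) = eigen_coord \<sigma> \<xi> + eigen_coord \<sigma> \<eta>"
  "eigen_coord \<sigma> (\<xi> - \<eta>) = eigen_coord \<sigma> \<xi> - eigen_coord \<sigma> \<eta>"
  by (simp_all add: eigen_coord_def algebra_simps)

lemma continuous_on_eigen_coord [continuous_intros]:
  "continuous_on S f \<Longrightarrow> continuous_on S (\<lambda>x. eigen_coord \<sigma> (f x))"
  unfolding eigen_coord_def by (intro continuous_intros)

text \<open>So \<open>\<xi>\<close> and \<open>e\<^sup>t\<^sup>A \<xi>\<close> are independent for \<open>t \<noteq> 0\<close>, unless \<open>\<xi>\<close> is an eigenvector of \<open>A\<close>.\<close>

lemma omega_exp_tA_self:
  "omega \<xi> (exp_tA t \<xi>) = sinh t * eigen_coord 1 \<xi> * eigen_coord (-1) \<xi>"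
  by (simp add: omega_def exp_tA_eq eigen_coord_def algebra_simps)

lemma of_int_scaleR_mem_additive_subgroup:
  fixes x :: "'a::real_vector"
  assumes diff: "\<And>x y. x \<in> S \<Longrightarrow> y \<in> S \<Longrightarrow> x - y \<in> S" and x: "x \<in> S"
  shows "of_int n *\<^sub>R x \<in> S"
proof (induction n rule: int_induct[of _ 0])
  case base
  then show ?case using diff[OF x x] by simp
next
  case (step1 i)
  have "0 - x \<in> S" using diff[OF diff[OF x x] x] by simp
  then have "of_int i *\<^sub>R x - (0 - x) \<in> S" using diff step1 by blast
  then show ?case by (simp add: scaleR_left_distrib)
next
  case (step2 i)
  then have "of_int i *\<^sub>R x - x \<in> S" using diff x by blast
  then show ?case by (simp add: scaleR_left_diff_distrib)
qed

lemma discrete_real_if_locally_finite: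
  fixes S :: "real set"
  assumes "\<And>R. finite (S \<inter> {-R..R})"
  shows "discrete S"
proof (rule discreteI)
  fix x assume "x \<in> S"
  have "\<not> x islimpt S"
  proof
    assume "x islimpt S"
    then have "infinite (S \<inter> ball x 1)"
      by (simp add: islimpt_eq_infinite_ball)
    moreover have "S \<inter> ball x 1 \<subseteq> S \<inter> {-(\<bar>x\<bar>+1)..\<bar>x\<bar>+1}"
      by (auto simp: dist_real_def)
    ultimately show False using assms finite_subset by blast
  qed
  then show "x isolated_in S" using \<open>x \<in> S\<close> by (simp add: isolated_in_islimpt_iff)
qed

lemma minus_floor_mult:
  fixes x c :: real
  assumes "c \<noteq> 0"
  shows "x + of_int (- \<lfloor>x / c\<rfloor>) * c = frac (x / c) * c"
  using assms by (simp add: frac_def algebra_simps)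

locale Osc_lattice =
  fixes L :: "osc set"
  assumes lattice: "lattice_subgroup L Osc"
begin

lemma discrete_L: "discrete_subgroup L Osc"
  using lattice by (simp add: lattice_subgroup_def)

sublocale L: subgroup L Osc
  using discrete_L by (simp add: discrete_subgroup_def)

lemma divide_mem: "x \<in> L \<Longrightarrow> y \<in> L \<Longrightarrow> x \<otimes>\<^bsub>Osc\<^esub> inv\<^bsub>Osc\<^esub> y \<in> L"
  by simp

text \<open>The successive layers of \<open>L\<close> for the chain centre \<open>\<subseteq>\<close> Heisenberg group \<open>\<subseteq>\<close> \<open>Osc\<close>, each of
  them an additive group.\<close>

definition heights :: "real set" where "heights = {t. \<exists>z \<xi>. (z, \<xi>, t) \<in> L}"
definition horizontals :: "complex set" where "horizontals = {\<xi>. \<exists>z. (z, \<xi>, 0) \<in> L}"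
definition centrals :: "real set" where "centrals = {z. (z, 0, 0) \<in> L}"

lemma heights_diff: "s \<in> heights \<Longrightarrow> t \<in> heights \<Longrightarrow> s - t \<in> heights"
  unfolding heights_def using divide_mem by (force simp: Osc_divide)

lemma horizontals_diff: "\<xi> \<in> horizontals \<Longrightarrow> \<eta> \<in> horizontals \<Longrightarrow> \<xi> - \<eta> \<in> horizontals"
  unfolding horizontals_def using divide_mem by (force simp: Osc_divide)

lemma horizontals_add: "\<xi> \<in> horizontals \<Longrightarrow> \<eta> \<in> horizontals \<Longrightarrow> \<xi> + \<eta> \<in> horizontals"
  unfolding horizontals_def using L.m_closed by (force simp: Osc_mult)

lemma centrals_diff: "x \<in> centrals \<Longrightarrow> y \<in> centrals \<Longrightarrow> x - y \<in> centrals"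
  unfolding centrals_def using divide_mem by (force simp: Osc_divide omega_linear)

text \<open>Conjugation by an element of height \<open>t\<close> acts on the horizontal layer as \<open>e\<^sup>t\<^sup>A\<close>.\<close>

lemma exp_tA_horizontals:
  assumes "t \<in> heights" "\<xi> \<in> horizontals"
  shows "exp_tA t \<xi> \<in> horizontals"
proof -
  obtain z \<eta> w where m: "(z, \<eta>, t) \<in> L" "(w, \<xi>, 0) \<in> L"
    using assms by (auto simp: heights_def horizontals_def)
  have "((z, \<eta>, t) \<otimes>\<^bsub>Osc\<^esub> (w, \<xi>, 0)) \<otimes>\<^bsub>Osc\<^esub> inv\<^bsub>Osc\<^esub> (z, \<eta>, t) \<in> L"
    using m by simp
  then show ?thesis by (auto simp: Osc_mult Osc_divide horizontals_def)
qed

text \<open>Otherwise \<open>t\<close> itself is a function on \<open>L\Osc\<close> that a translation raises by \<open>1\<close>.\<close>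

lemma nonzero_height: "\<exists>t\<in>heights. t \<noteq> 0"
proof (rule ccontr)
  assume none: "\<not> (\<exists>t\<in>heights. t \<noteq> 0)"
  show False
  proof (rule lattice_no_translation_cocycle[OF group_Osc UNIV_Osc lattice])
    show "continuous_on UNIV (\<lambda>g. snd (snd g) :: real)" by (intro continuous_intros)
    show "snd (snd (\<gamma> \<otimes>\<^bsub>Osc\<^esub> g)) = snd (snd g)" if "\<gamma> \<in> L" for \<gamma> g
      using that none by (cases \<gamma>; cases g) (auto simp: Osc_mult heights_def)
    show "snd (snd (g \<otimes>\<^bsub>Osc\<^esub> (0, 0, 1))) = snd (snd g) + 1" for g
      by (cases g) (simp add: Osc_mult)
  qed
qed

text \<open>Project \<open>Osc\<close> to the affine group of the line by \<open>(z, \<xi>, t) \<mapsto> (x \<mapsto> e\<^sup>\<sigma>\<^sup>t x + l \<xi>)\<close>, where \<open>l\<close> is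
  the eigencoordinate.  If \<open>l\<close> vanished on the horizontal elements of \<open>L\<close>, hence on its
  commutators, the image of \<open>L\<close> would be abelian.  Since it contains a map with linear part different
  from \<open>1\<close>, all of it would fix the fixed point \<open>v\<close> of that map.  Then \<open>e\<^sup>-\<^sup>\<sigma>\<^sup>t (l \<xi> - v)\<close> would be a
  function on \<open>L\Osc\<close> that a horizontal translation raises by \<open>1\<close>.\<close>

lemma horizontal_eigen_coord:
  assumes \<sigma>: "\<sigma> = 1 \<or> \<sigma> = -1"
  shows "\<exists>\<xi>\<in>horizontals. eigen_coord \<sigma> \<xi> \<noteq> 0"
proof (rule ccontr)
  assume none: "\<not> (\<exists>\<xi>\<in>horizontals. eigen_coord \<sigma> \<xi> \<noteq> 0)"
  obtain z\<^sub>0 \<xi>\<^sub>0 t\<^sub>0 where \<gamma>\<^sub>0: "(z\<^sub>0, \<xi>\<^sub>0, t\<^sub>0) \<in> L" "t\<^sub>0 \<noteq> 0"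
    using nonzero_height by (auto simp: heights_def)
  have "exp (\<sigma> * t\<^sub>0) \<noteq> 1" using \<sigma> \<gamma>\<^sub>0(2) by auto
  define v where "v = eigen_coord \<sigma> \<xi>\<^sub>0 / (1 - exp (\<sigma> * t\<^sub>0))"
  have fixes_v: "eigen_coord \<sigma> \<xi> = (1 - exp (\<sigma> * t)) * v" if \<gamma>: "(z, \<xi>, t) \<in> L" for z \<xi> t
  proof -
    have "((z, \<xi>, t) \<otimes>\<^bsub>Osc\<^esub> (z\<^sub>0, \<xi>\<^sub>0, t\<^sub>0)) \<otimes>\<^bsub>Osc\<^esub>
        inv\<^bsub>Osc\<^esub> ((z\<^sub>0, \<xi>\<^sub>0, t\<^sub>0) \<otimes>\<^bsub>Osc\<^esub> (z, \<xi>, t)) \<in> L"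
      using \<gamma> \<gamma>\<^sub>0(1) by (intro divide_mem L.m_closed)
    then have "(\<xi> + exp_tA t \<xi>\<^sub>0) - (\<xi>\<^sub>0 + exp_tA t\<^sub>0 \<xi>) \<in> horizontals"
      by (auto simp: Osc_mult Osc_divide horizontals_def add.commute)
    with none have "eigen_coord \<sigma> ((\<xi> + exp_tA t \<xi>\<^sub>0) - (\<xi>\<^sub>0 + exp_tA t\<^sub>0 \<xi>)) = 0"
      by blast
    then have "(1 - exp (\<sigma> * t\<^sub>0)) * eigen_coord \<sigma> \<xi> = (1 - exp (\<sigma> * t)) * eigen_coord \<sigma> \<xi>\<^sub>0"
      by (simp add: eigen_coord_linear eigen_coord_exp_tA[OF \<sigma>] algebra_simps)
    then show ?thesis
      using \<open>exp (\<sigma> * t\<^sub>0) \<noteq> 1\<close> by (simp add: v_def field_simps)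
  qed
  define f where "f = (\<lambda>(z :: real, \<xi>, t). exp (- (\<sigma> * t)) * (eigen_coord \<sigma> \<xi> - v))"
  show False
  proof (rule lattice_no_translation_cocycle[OF group_Osc UNIV_Osc lattice])
    show "continuous_on UNIV f"
      unfolding f_def case_prod_unfold by (intro continuous_intros)
    show "f (\<gamma> \<otimes>\<^bsub>Osc\<^esub> g) = f g" if "\<gamma> \<in> L" for \<gamma> g
    proof -
      obtain z \<xi> t w \<eta> s where e: "\<gamma> = (z, \<xi>, t)" "g = (w, \<eta>, s)" by (cases \<gamma>; cases g) auto
      have K: "eigen_coord \<sigma> (\<xi> + exp_tA t \<eta>) - v = exp (\<sigma> * t) * (eigen_coord \<sigma> \<eta> - v)"
        using fixes_v[OF that[unfolded e(1)]]
        by (simp add: eigen_coord_linear eigen_coord_exp_tA[OF \<sigma>] algebra_simps)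
      have "exp (- (\<sigma> * (t + s))) * exp (\<sigma> * t) = exp (- (\<sigma> * s))"
        by (simp add: algebra_simps flip: exp_add)
      then show ?thesis by (simp add: e Osc_mult f_def K flip: mult.assoc)
    qed
    show "f (g \<otimes>\<^bsub>Osc\<^esub> (0, 1, 0)) = f g + 1" for g
      by (cases g) (simp add: Osc_mult f_def eigen_coord_linear eigen_coord_exp_tA[OF \<sigma>]
          exp_minus field_simps, simp add: eigen_coord_def)
  qed
qed

lemma horizontal_generic:
  "\<exists>\<xi>\<in>horizontals. eigen_coord 1 \<xi> \<noteq> 0 \<and> eigen_coord (-1) \<xi> \<noteq> 0"
proof -
  obtain \<xi> \<eta> where *: "\<xi> \<in> horizontals" "eigen_coord 1 \<xi> \<noteq> 0"
    "\<eta> \<in> horizontals" "eigen_coord (-1) \<eta> \<noteq> 0"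
    using horizontal_eigen_coord[of 1] horizontal_eigen_coord[of "-1"] by auto
  show ?thesis
  proof (cases "eigen_coord (-1) \<xi> = 0 \<and> eigen_coord 1 \<eta> = 0")
    case True
    then show ?thesis
      using * horizontals_add[of \<xi> \<eta>] by (intro bexI[of _ "\<xi> + \<eta>"]) (auto simp: eigen_coord_linear)
  next
    case False
    then show ?thesis using * by blast
  qed
qed

lemma horizontals_span: "\<exists>\<xi>\<in>horizontals. \<exists>\<eta>\<in>horizontals. omega \<xi> \<eta> \<noteq> 0"
proof -
  obtain t \<xi> where "t \<in> heights" "t \<noteq> 0" "\<xi> \<in> horizontals"
    "eigen_coord 1 \<xi> \<noteq> 0" "eigen_coord (-1) \<xi> \<noteq> 0"
    using nonzero_height horizontal_generic by blast
  then show ?thesis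
    using exp_tA_horizontals omega_exp_tA_self[of \<xi> t] by force
qed

text \<open>Commutators of horizontal elements are central, with value \<open>\<omega>\<close>.\<close>

lemma nonzero_central: "\<exists>c\<in>centrals. c \<noteq> 0"
proof -
  obtain \<xi> \<eta> z w where *: "(z, \<xi>, 0) \<in> L" "(w, \<eta>, 0) \<in> L" "omega \<xi> \<eta> \<noteq> 0"
    using horizontals_span by (auto simp: horizontals_def)
  have "((z, \<xi>, 0) \<otimes>\<^bsub>Osc\<^esub> (w, \<eta>, 0)) \<otimes>\<^bsub>Osc\<^esub> inv\<^bsub>Osc\<^esub> ((w, \<eta>, 0) \<otimes>\<^bsub>Osc\<^esub> (z, \<xi>, 0)) \<in> L"
    using * by (intro divide_mem L.m_closed)
  moreover have "omega \<eta> \<xi> = - omega \<xi> \<eta>" by (simp add: omega_def)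
  ultimately have "omega \<xi> \<eta> \<in> centrals"
    by (simp add: Osc_mult Osc_divide centrals_def omega_linear add.commute)
  then show ?thesis using *(3) by blast
qed

text \<open>Modulo the central elements of \<open>L\<close>, a horizontal vector in \<open>B\<close> has a lift to \<open>L\<close> in a fixed
  compact set.\<close>

lemma finite_horizontals_Int_compact:
  assumes "compact B"
  shows "finite (horizontals \<inter> B)"
proof -
  obtain c where c: "c \<in> centrals" "c \<noteq> 0" using nonzero_central by blast
  let ?K = "{-\<bar>c\<bar>..\<bar>c\<bar>} \<times> B \<times> {0::real}"
  have "finite (L \<inter> ?K)"
    using assms
    by (intro finite_discrete_subgroup_Int_compact[OF group_Osc UNIV_Osc
          Osc.continuous_divide discrete_L] compact_Times) auto
  moreover have "horizontals \<inter> B \<subseteq> (\<lambda>(z, \<xi>, t). \<xi>) ` (L \<inter> ?K)"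
  proof
    fix \<xi> assume \<xi>: "\<xi> \<in> horizontals \<inter> B"
    then obtain z where z: "(z, \<xi>, 0) \<in> L" by (auto simp: horizontals_def)
    define n where "n = - \<lfloor>z / c\<rfloor>"
    have "of_int n * c \<in> centrals"
      using of_int_scaleR_mem_additive_subgroup[OF centrals_diff c(1)]
      unfolding real_scaleR_def by blast
    then have "(of_int n * c, 0, 0) \<otimes>\<^bsub>Osc\<^esub> (z, \<xi>, 0) \<in> L"
      using z by (simp add: centrals_def)
    then have "(z + of_int n * c, \<xi>, 0) \<in> L" by (simp add: Osc_mult omega_linear add.commute)
    moreover have "z + of_int n * c = frac (z / c) * c"
      unfolding n_def using c(2) by (rule minus_floor_mult)
    moreover have "\<bar>frac (z / c) * c\<bar> \<le> \<bar>c\<bar>"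
      using frac_lt_1[of "z / c"] frac_ge_0[of "z / c"]
      by (simp add: abs_mult mult_left_le_one_le)
    ultimately have "(frac (z / c) * c, \<xi>, 0) \<in> L \<inter> ?K" using \<xi> by (auto simp: abs_le_iff)
    then show "\<xi> \<in> (\<lambda>(z, \<xi>, t). \<xi>) ` (L \<inter> ?K)" by force
  qed
  ultimately show ?thesis by (meson finite_imageI finite_subset)
qed

text \<open>The heights act faithfully on a horizontal vector with nonzero eigencoordinate, and bounded
  heights move it within a compact set, which contains only finitely many horizontal vectors.\<close>

lemma finite_heights: "finite (heights \<inter> {-R..R})"
proof -
  obtain \<xi> where \<xi>: "\<xi> \<in> horizontals" "eigen_coord 1 \<xi> \<noteq> 0"
    using horizontal_generic by blast
  have "compact ((\<lambda>t. exp_tA t \<xi>) ` {-R..R})"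
    by (intro compact_continuous_image continuous_intros) auto
  then have "finite (horizontals \<inter> (\<lambda>t. exp_tA t \<xi>) ` {-R..R})"
    by (rule finite_horizontals_Int_compact)
  moreover have "(\<lambda>t. exp_tA t \<xi>) ` (heights \<inter> {-R..R})
      \<subseteq> horizontals \<inter> (\<lambda>t. exp_tA t \<xi>) ` {-R..R}"
    using exp_tA_horizontals \<xi>(1) by auto
  ultimately have "finite ((\<lambda>t. exp_tA t \<xi>) ` (heights \<inter> {-R..R}))"
    by (rule finite_subset[rotated])
  moreover have "inj (\<lambda>t. exp_tA t \<xi>)"
  proof (rule injI)
    fix s t assume "exp_tA s \<xi> = exp_tA t \<xi>"
    from arg_cong[OF this, of "eigen_coord 1"] show "s = t"
      using \<xi>(2) by (simp add: eigen_coord_exp_tA)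
  qed
  ultimately show ?thesis by (meson finite_imageD inj_on_subset subset_UNIV)
qed

text \<open>An element of \<open>Osc\<close> is moved into a compact box layer by layer: its height is reduced by a
  nonzero height of \<open>L\<close>, then its horizontal part by two independent horizontal vectors, which
  leaves the height alone, then its central part.\<close>

lemma cocompact: "\<exists>C. compact C \<and> (\<forall>q. \<exists>\<gamma>\<in>L. \<exists>c\<in>C. q = \<gamma> \<otimes>\<^bsub>Osc\<^esub> c)"
proof -
  obtain t\<^sub>0 where t\<^sub>0: "t\<^sub>0 \<in> heights" "t\<^sub>0 \<noteq> 0" using nonzero_height by blast
  obtain \<xi>\<^sub>1 \<xi>\<^sub>2 where \<xi>\<^sub>1: "\<xi>\<^sub>1 \<in> horizontals" and \<xi>\<^sub>2: "\<xi>\<^sub>2 \<in> horizontals"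
    and indep: "omega \<xi>\<^sub>1 \<xi>\<^sub>2 \<noteq> 0"
    using horizontals_span by blast
  obtain c where c: "c \<in> centrals" "c \<noteq> 0" using nonzero_central by blast
  define P where "P = (\<lambda>(a :: real, b :: real, b' :: real, d :: real).
    (a * c, b *\<^sub>R \<xi>\<^sub>1 + b' *\<^sub>R \<xi>\<^sub>2, d * t\<^sub>0))"
  define C where "C = P ` ({0..1} \<times> {0..1} \<times> {0..1} \<times> {0..1})"
  have "compact C"
    unfolding C_def P_def case_prod_unfold
    by (intro compact_continuous_image continuous_intros compact_Times) auto
  have unit: "frac x \<in> {0..1}" for x :: real
    using frac_lt_1[of x] frac_ge_0[of x] by simp
  have into_C: "\<exists>\<gamma>\<in>L. \<gamma> \<otimes>\<^bsub>Osc\<^esub> q \<in> C" for q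
  proof -
    obtain z \<xi> t where q: "q = (z, \<xi>, t)" by (cases q) auto
    have "of_int (- \<lfloor>t / t\<^sub>0\<rfloor>) * t\<^sub>0 \<in> heights"
      using of_int_scaleR_mem_additive_subgroup[OF heights_diff t\<^sub>0(1)]
      unfolding real_scaleR_def by blast
    then obtain z\<^sub>1 \<eta>\<^sub>1 where \<gamma>\<^sub>1: "(z\<^sub>1, \<eta>\<^sub>1, of_int (- \<lfloor>t / t\<^sub>0\<rfloor>) * t\<^sub>0) \<in> L" (is "?\<gamma>\<^sub>1 \<in> L")
      unfolding heights_def by blast
    obtain z' \<xi>' where q': "?\<gamma>\<^sub>1 \<otimes>\<^bsub>Osc\<^esub> q = (z', \<xi>', frac (t / t\<^sub>0) * t\<^sub>0)"
      using minus_floor_mult[OF t\<^sub>0(2), of t] by (simp add: q Osc_mult add.commute)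
    define b where "b = omega \<xi>' \<xi>\<^sub>2 / omega \<xi>\<^sub>1 \<xi>\<^sub>2"
    define b' where "b' = omega \<xi>\<^sub>1 \<xi>' / omega \<xi>\<^sub>1 \<xi>\<^sub>2"
    have \<xi>': "\<xi>' = b *\<^sub>R \<xi>\<^sub>1 + b' *\<^sub>R \<xi>\<^sub>2"
    proof -
      have "omega \<xi>\<^sub>1 \<xi>\<^sub>2 *\<^sub>R \<xi>' = omega \<xi>' \<xi>\<^sub>2 *\<^sub>R \<xi>\<^sub>1 + omega \<xi>\<^sub>1 \<xi>' *\<^sub>R \<xi>\<^sub>2"
        by (simp add: omega_def complex_eq_iff algebra_simps)
      from arg_cong[OF this, of "\<lambda>x. x /\<^sub>R omega \<xi>\<^sub>1 \<xi>\<^sub>2"] show ?thesis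
        using indep by (simp add: b_def b'_def scaleR_right_distrib divide_inverse_commute)
    qed
    have "of_int (- \<lfloor>b\<rfloor>) *\<^sub>R \<xi>\<^sub>1 + of_int (- \<lfloor>b'\<rfloor>) *\<^sub>R \<xi>\<^sub>2 \<in> horizontals"
      by (intro horizontals_add of_int_scaleR_mem_additive_subgroup horizontals_diff \<xi>\<^sub>1 \<xi>\<^sub>2)
    then obtain z\<^sub>2 where \<gamma>\<^sub>2: "(z\<^sub>2, of_int (- \<lfloor>b\<rfloor>) *\<^sub>R \<xi>\<^sub>1 + of_int (- \<lfloor>b'\<rfloor>) *\<^sub>R \<xi>\<^sub>2, 0) \<in> L"
      (is "?\<gamma>\<^sub>2 \<in> L")
      unfolding horizontals_def by blast
    obtain z'' where q'': "?\<gamma>\<^sub>2 \<otimes>\<^bsub>Osc\<^esub> (z', \<xi>', frac (t / t\<^sub>0) * t\<^sub>0)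
        = (z'', frac b *\<^sub>R \<xi>\<^sub>1 + frac b' *\<^sub>R \<xi>\<^sub>2, frac (t / t\<^sub>0) * t\<^sub>0)"
      by (simp add: Osc_mult \<xi>' frac_def scaleR_left_diff_distrib)
    have "of_int (- \<lfloor>z'' / c\<rfloor>) * c \<in> centrals"
      using of_int_scaleR_mem_additive_subgroup[OF centrals_diff c(1)]
      unfolding real_scaleR_def by blast
    then have \<gamma>\<^sub>3: "(of_int (- \<lfloor>z'' / c\<rfloor>) * c, 0, 0) \<in> L" (is "?\<gamma>\<^sub>3 \<in> L")
      unfolding centrals_def by blast
    have "?\<gamma>\<^sub>3 \<otimes>\<^bsub>Osc\<^esub> (z'', frac b *\<^sub>R \<xi>\<^sub>1 + frac b' *\<^sub>R \<xi>\<^sub>2, frac (t / t\<^sub>0) * t\<^sub>0)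
        = P (frac (z'' / c), frac b, frac b', frac (t / t\<^sub>0))"
      using minus_floor_mult[OF c(2), of z''] by (simp add: Osc_mult omega_linear P_def add.commute)
    then have "?\<gamma>\<^sub>3 \<otimes>\<^bsub>Osc\<^esub> (?\<gamma>\<^sub>2 \<otimes>\<^bsub>Osc\<^esub> (?\<gamma>\<^sub>1 \<otimes>\<^bsub>Osc\<^esub> q)) \<in> C"
      using unit by (simp only: q' q'' C_def) blast
    then have "(?\<gamma>\<^sub>3 \<otimes>\<^bsub>Osc\<^esub> ?\<gamma>\<^sub>2 \<otimes>\<^bsub>Osc\<^esub> ?\<gamma>\<^sub>1) \<otimes>\<^bsub>Osc\<^esub> q \<in> C"
      by (simp only: Osc.Q.m_assoc UNIV_Osc UNIV_I)
    moreover have "?\<gamma>\<^sub>3 \<otimes>\<^bsub>Osc\<^esub> ?\<gamma>\<^sub>2 \<otimes>\<^bsub>Osc\<^esub> ?\<gamma>\<^sub>1 \<in> L"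
      using \<gamma>\<^sub>1 \<gamma>\<^sub>2 \<gamma>\<^sub>3 by (intro L.m_closed)
    ultimately show ?thesis by blast
  qed
  have "\<exists>\<gamma>\<in>L. \<exists>c\<in>C. q = \<gamma> \<otimes>\<^bsub>Osc\<^esub> c" for q
  proof -
    obtain \<gamma> where \<gamma>: "\<gamma> \<in> L" "\<gamma> \<otimes>\<^bsub>Osc\<^esub> q \<in> C" using into_C by blast
    have "q = inv\<^bsub>Osc\<^esub> \<gamma> \<otimes>\<^bsub>Osc\<^esub> (\<gamma> \<otimes>\<^bsub>Osc\<^esub> q)"
      by (simp add: UNIV_Osc flip: Osc.Q.m_assoc)
    then show ?thesis using \<gamma> by (meson L.m_inv_closed)
  qed
  with \<open>compact C\<close> show ?thesis by blast
qed

proposition straight: "straight_quotient (iota ` L)"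
  unfolding straight_quotient_def
proof
  obtain C where "compact C" "\<And>q. \<exists>\<gamma>\<in>L. \<exists>c\<in>C. q = \<gamma> \<otimes>\<^bsub>Osc\<^esub> c"
    using cocompact by blast
  then show "compact_quotient (iota ` L)"
    by (rule Osc.compact_quotient_image[OF discrete_L])
  have p: "p_proj ` iota ` L = (\<lambda>t. t / 2) ` heights"
    by (force simp: image_image p_proj_def iota_def heights_def)
  show "discrete (p_proj ` iota ` L)"
    unfolding p
  proof (rule discrete_real_if_locally_finite)
    fix R
    have "(\<lambda>t. t / 2) ` heights \<inter> {-R..R} \<subseteq> (\<lambda>t. t / 2) ` (heights \<inter> {-(2 * R)..2 * R})"
      by force
    then show "finite ((\<lambda>t. t / 2) ` heights \<inter> {-R..R})"
      using finite_heights finite_subset by blast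
  qed
qed

end

section \<open>A non-straight quotient\<close>

text \<open>Heisenberg group times \<open>\<real>\<close>.  With the cocycle \<open>\<omega>\<close> in place of \<open>\<omega> / 2\<close> the integral points
  form a subgroup.\<close>

definition Heis_R :: "osc monoid" where
  "Heis_R = \<lparr>carrier = UNIV,
     mult = (\<lambda>(z, \<xi>, t) (z', \<xi>', t'). (z + z' + omega \<xi> \<xi>', \<xi> + \<xi>', t + t')),
     one = (0, 0, 0)\<rparr>"

lemma Heis_R_mult:
  "(z, \<xi>, t) \<otimes>\<^bsub>Heis_R\<^esub> (z', \<xi>', t') = (z + z' + omega \<xi> \<xi>', \<xi> + \<xi>', t + t')"
  by (simp add: Heis_R_def)

lemma UNIV_Heis_R: "carrier Heis_R = UNIV"
  by (simp add: Heis_R_def)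

lemma one_Heis_R: "\<one>\<^bsub>Heis_R\<^esub> = (0, 0, 0)"
  by (simp add: Heis_R_def)

lemma group_Heis_R: "group Heis_R"
proof (rule groupI)
  show "\<exists>y\<in>carrier Heis_R. y \<otimes>\<^bsub>Heis_R\<^esub> x = \<one>\<^bsub>Heis_R\<^esub>" for x
  proof -
    obtain z \<xi> t where "x = (z, \<xi>, t)" by (cases x) auto
    then have "(- z, - \<xi>, - t) \<otimes>\<^bsub>Heis_R\<^esub> x = \<one>\<^bsub>Heis_R\<^esub>"
      by (simp add: Heis_R_mult one_Heis_R)
    then show ?thesis unfolding UNIV_Heis_R by blast
  qed
qed (auto simp: UNIV_Heis_R Heis_R_mult one_Heis_R omega_linear)

lemma Heis_R_inv: "inv\<^bsub>Heis_R\<^esub> (z, \<xi>, t) = (- z, - \<xi>, - t)"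
  by (rule group.inv_equality[OF group_Heis_R]) (auto simp: UNIV_Heis_R Heis_R_mult one_Heis_R)

text \<open>On vectors \<open>(\<xi>, -A\<xi>)\<close> the map \<open>\<phi>\<close> is \<open>-A\<close>, so the action of \<open>(t, t)\<close> on them is
  \<open>e\<^sup>t\<^sup>A e\<^sup>-\<^sup>t\<^sup>A = 1\<close>.  This is why the semidirect product becomes direct on this transversal.  The
  central cocycle is \<open>(\<omega>(\<xi>, \<xi>') - \<omega>(A\<xi>, A\<xi>')) / 2 = \<omega>(\<xi>, \<xi>')\<close>, because \<open>det A = -1\<close>.\<close>

lemma transversal_hom: "transversal (-1) \<in> hom Heis_R Isom"
proof -
  have "transversal (-1) (x \<otimes>\<^bsub>Heis_R\<^esub> y) = transversal (-1) x \<otimes>\<^bsub>Isom\<^esub> transversal (-1) y" for x y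
  proof -
    obtain z \<xi> t z' \<xi>' t' where e: "x = (z, \<xi>, t)" "y = (z', \<xi>', t')" by (cases x; cases y) auto
    have rot: "cosh t *\<^sub>R \<eta> - sinh t *\<^sub>R A_map \<eta> = exp_tA (- t) \<eta>" for \<eta>
      by (simp add: exp_tA_eq A_map_def complex_eq_iff)
    have 1: "cosh t *\<^sub>R \<xi>' + sinh t *\<^sub>R (- A_map \<xi>') = exp_tA (- t) \<xi>'"
      using rot[of \<xi>'] by simp
    have 2: "sinh t *\<^sub>R \<xi>' + cosh t *\<^sub>R (- A_map \<xi>') = exp_tA (- t) (- A_map \<xi>')"
      using rot[of "- A_map \<xi>'"] by (simp add: exp_tA_eq A_map_def complex_eq_iff)
    show ?thesis
      by (simp add: e transversal_def Heis_R_mult Isom_mult 1[simplified] 2[simplified])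
        (simp add: A_map_def omega_def complex_eq_iff)
  qed
  then show ?thesis by (auto simp: hom_def Isom_def)
qed

interpretation Heis_R: simply_transitive Heis_R "transversal (-1)" "transversal_coords (-1)"
proof (rule simply_transitive.intro)
  have "(\<lambda>(x, y). x \<otimes>\<^bsub>Heis_R\<^esub> inv\<^bsub>Heis_R\<^esub> y)
      = (\<lambda>((z, \<xi>, t), (z', \<xi>', t')). (z - z' - omega \<xi> \<xi>', \<xi> - \<xi>', t - t'))"
    by (simp add: fun_eq_iff Heis_R_inv Heis_R_mult)
  then show "continuous_on UNIV (\<lambda>(x, y). x \<otimes>\<^bsub>Heis_R\<^esub> inv\<^bsub>Heis_R\<^esub> y)"
    by (simp only: case_prod_unfold) (intro continuous_intros; simp)
qed (use group_Heis_R UNIV_Heis_R transversal_hom continuous_on_transversal continuous_on_transversal_coords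
      transversal_coords_mult[of "-1"] transversal_decomposition[of "-1"] in auto)

text \<open>The standard lattice of the Heisenberg group times \<open>\<int>\<close>, sheared along the homomorphism
  \<open>(z, \<xi>, t) \<mapsto> \<alpha> Re \<xi>\<close> into the second factor.  Shearing keeps it discrete and cocompact, but its
  projection to the second factor is now \<open>\<int> + \<alpha>\<int>\<close>.\<close>

definition sheared_lattice :: "real \<Rightarrow> osc set" where
  "sheared_lattice \<alpha> = {(z, \<xi>, t). z \<in> \<int> \<and> Re \<xi> \<in> \<int> \<and> Im \<xi> \<in> \<int> \<and> t - \<alpha> * Re \<xi> \<in> \<int>}"

lemma discrete_subgroup_sheared_lattice: "discrete_subgroup (sheared_lattice \<alpha>) Heis_R"
  unfolding discrete_subgroup_def
proof
  show "subgroup (sheared_lattice \<alpha>) Heis_R"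
  proof (rule group.subgroupI[OF group_Heis_R])
    have "(0, 0, 0) \<in> sheared_lattice \<alpha>" by (simp add: sheared_lattice_def)
    then show "sheared_lattice \<alpha> \<noteq> {}" by blast
    show "inv\<^bsub>Heis_R\<^esub> x \<in> sheared_lattice \<alpha>" if x: "x \<in> sheared_lattice \<alpha>" for x
    proof (cases x)
      case (fields z \<xi> t)
      have "\<alpha> * Re \<xi> - t \<in> \<int>"
        using x fields Ints_minus[of "t - \<alpha> * Re \<xi>"] by (simp add: sheared_lattice_def)
      then show ?thesis
        using x fields by (simp add: Heis_R_inv sheared_lattice_def)
    qed
    show "x \<otimes>\<^bsub>Heis_R\<^esub> y \<in> sheared_lattice \<alpha>"
      if xy: "x \<in> sheared_lattice \<alpha>" "y \<in> sheared_lattice \<alpha>" for x y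
    proof -
      obtain z \<xi> t z' \<xi>' t' where e: "x = (z, \<xi>, t)" "y = (z', \<xi>', t')" by (cases x; cases y) auto
      have "t + t' - \<alpha> * (Re \<xi> + Re \<xi>') = (t - \<alpha> * Re \<xi>) + (t' - \<alpha> * Re \<xi>')"
        by (simp add: algebra_simps)
      also have "\<dots> \<in> \<int>" using xy by (intro Ints_add) (auto simp: e sheared_lattice_def)
      finally show ?thesis
        using xy by (simp add: e Heis_R_mult sheared_lattice_def omega_def)
    qed
  qed (simp add: UNIV_Heis_R)
  have eq: "x = y" if "x \<in> sheared_lattice \<alpha>" "y \<in> sheared_lattice \<alpha>" "dist x y < 1" for x y
  proof -
    obtain z \<xi> t z' \<xi>' t' where e: "x = (z, \<xi>, t)" "y = (z', \<xi>', t')" by (cases x; cases y) auto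
    have d: "\<bar>z - z'\<bar> < 1" "dist \<xi> \<xi>' < 1" "\<bar>t - t'\<bar> < 1"
      using that(3) dist_fst_le[of x y] dist_snd_le[of x y]
        dist_fst_le[of "snd x" "snd y"] dist_snd_le[of "snd x" "snd y"]
      by (auto simp: e dist_real_def)
    then have "\<bar>Re \<xi> - Re \<xi>'\<bar> < 1" "\<bar>Im \<xi> - Im \<xi>'\<bar> < 1"
      using abs_Re_le_cmod[of "\<xi> - \<xi>'"] abs_Im_le_cmod[of "\<xi> - \<xi>'"] by (auto simp: dist_norm)
    with d that(1,2) have "z = z'" "Re \<xi> = Re \<xi>'" "Im \<xi> = Im \<xi>'"
      by (auto simp: e sheared_lattice_def Ints_eq_abs_less1)
    moreover have "t - \<alpha> * Re \<xi> = t' - \<alpha> * Re \<xi>'"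
      using that(1,2) d(3) \<open>Re \<xi> = Re \<xi>'\<close> by (simp add: e sheared_lattice_def Ints_eq_abs_less1)
    ultimately show ?thesis by (simp add: e complex_eq_iff)
  qed
  show "discrete (sheared_lattice \<alpha>)"
  proof (rule discreteI)
    fix x assume "x \<in> sheared_lattice \<alpha>"
    then have "y = x" if "y \<in> ball x 1 \<inter> sheared_lattice \<alpha>" for y
      using eq[of x y] that by simp
    then have "ball x 1 \<inter> sheared_lattice \<alpha> = {x}"
      using \<open>x \<in> sheared_lattice \<alpha>\<close> by (intro equalityI subsetI) simp_all
    then show "x isolated_in sheared_lattice \<alpha>"
      unfolding isolated_in_def using \<open>x \<in> sheared_lattice \<alpha>\<close> open_ball by blast
  qed
qed

lemma sheared_lattice_cocompact:
  "\<exists>\<gamma>\<in>sheared_lattice \<alpha>. \<exists>c\<in>{0..1} \<times> cbox 0 (Complex 1 1) \<times> {0..1}. q = \<gamma> \<otimes>\<^bsub>Heis_R\<^esub> c"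
proof -
  obtain z \<xi> t where q: "q = (z, \<xi>, t)" by (cases q) auto
  define \<zeta> where "\<zeta> = Complex (of_int \<lfloor>Re \<xi>\<rfloor>) (of_int \<lfloor>Im \<xi>\<rfloor>)"
  define u where "u = t - \<alpha> * Re \<zeta>"
  \<comment> \<open>The central coordinate that remains after the other parts of the lattice element are split off.\<close>
  define w where "w = z - omega \<zeta> (\<xi> - \<zeta>)"
  have "(of_int \<lfloor>w\<rfloor>, \<zeta>, of_int \<lfloor>u\<rfloor> + \<alpha> * Re \<zeta>) \<in> sheared_lattice \<alpha>"
    by (simp add: sheared_lattice_def \<zeta>_def)
  moreover have "(frac w, \<xi> - \<zeta>, frac u) \<in> {0..1} \<times> cbox 0 (Complex 1 1) \<times> {0..1}"
    using frac_lt_1[of w] frac_ge_0[of w] frac_lt_1[of u] frac_ge_0[of u]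
      frac_lt_1[of "Re \<xi>"] frac_ge_0[of "Re \<xi>"] frac_lt_1[of "Im \<xi>"] frac_ge_0[of "Im \<xi>"]
    by (simp add: \<zeta>_def in_cbox_complex_iff frac_def)
  moreover have "q = (of_int \<lfloor>w\<rfloor>, \<zeta>, of_int \<lfloor>u\<rfloor> + \<alpha> * Re \<zeta>) \<otimes>\<^bsub>Heis_R\<^esub> (frac w, \<xi> - \<zeta>, frac u)"
    by (simp add: q Heis_R_mult frac_def w_def u_def)
  ultimately show ?thesis by blast
qed

lemma sqrt_2_minus_1_power: "\<exists>n a :: int. (sqrt 2 - 1) ^ m = of_int n + sqrt 2 * of_int a"
proof (induction m)
  case 0
  show ?case by (intro exI[of _ 1] exI[of _ 0]) simp
next
  case (Suc m)
  then obtain n a :: int where "(sqrt 2 - 1) ^ m = of_int n + sqrt 2 * of_int a" by blast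
  then have "(sqrt 2 - 1) ^ Suc m = of_int (2 * a - n) + sqrt 2 * of_int (n - a)"
    by (simp add: algebra_simps flip: mult.assoc)
  then show ?case by blast
qed

text \<open>The projections of the lattice elements are the elements of \<open>\<int>[\<surd>2]\<close>, among them the powers
  of \<open>\<surd>2 - 1\<close>, which are nonzero and tend to \<open>0\<close>.\<close>

proposition non_straight: "non_straight_quotient (transversal (-1) ` sheared_lattice (sqrt 2))"
  unfolding non_straight_quotient_def
proof
  show "compact_quotient (transversal (-1) ` sheared_lattice (sqrt 2))"
    by (rule Heis_R.compact_quotient_image[OF discrete_subgroup_sheared_lattice _
          sheared_lattice_cocompact]) (intro compact_Times compact_Icc compact_cbox)
  let ?T = "p_proj ` transversal (-1) ` sheared_lattice (sqrt 2)"
  have T: "of_int n + sqrt 2 * of_int a \<in> ?T" for n a :: int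
  proof -
    have "(0, Complex (of_int a) 0, of_int n + sqrt 2 * of_int a) \<in> sheared_lattice (sqrt 2)"
      by (simp add: sheared_lattice_def)
    then show ?thesis by (force simp: image_iff transversal_def p_proj_def)
  qed
  have r: "0 < sqrt 2 - 1" "sqrt 2 - 1 < (1::real)"
    using sqrt2_less_2 by auto
  show "\<not> discrete ?T"
  proof
    assume "discrete ?T"
    moreover have "0 \<in> ?T" using T[of 0 0] by simp
    ultimately obtain e where e: "e > 0" "\<And>y. y \<in> ?T \<Longrightarrow> dist 0 y < e \<Longrightarrow> y = 0"
      unfolding discrete_def isolated_in_dist_Ex_iff by blast
    obtain m where "(sqrt 2 - 1) ^ m < e" using real_arch_pow_inv[OF e(1) r(2)] by blast
    moreover have "(sqrt 2 - 1) ^ m \<in> ?T" using sqrt_2_minus_1_power[of m] T by metis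
    ultimately show False using e(2)[of "(sqrt 2 - 1) ^ m"] r(1) by (simp add: dist_real_def)
  qed
qed

theorem proposition10p3:
  shows "(\<forall>L :: osc set. lattice_subgroup L Osc \<longrightarrow> straight_quotient (iota ` L)) \<and>
         (\<exists>\<Gamma> :: isom set. non_straight_quotient \<Gamma>)"
  using Osc_lattice.straight[OF Osc_lattice.intro] non_straight by blast

end
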